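(* Let $\mathfrak A$ be a J-algebra or a relation algebra, and let $a,b\in A$ satisfy $$1'=a^{\smile};a=b^{\smile};b=a;a^{\smile}\cdot b;b^{\smile}\quad\text{and}\quad 1=a^{\smile};b=a;1=b;1.$$ Define the following elements of $\mathfrak A$: \begin{align*} K&=a,\qquad L=b,\qquad U=a^{\smile}\cdot b^{\smile},\qquad P=a;b^{\smile}\cdot b;a^{\smile},\qquad P_0=a;P;a^{\smile}\cdot b;b^{\smile},\\ A=R&=a;(a^{\smile})^2\cdot b;a;b^{\smile};a^{\smile}\cdot b^2;b^{\smile},\qquad R_0=a;R;a^{\smile}\cdot b;b^{\smile},\qquad B=a;a^{\smile}\cdot b;A;b^{\smile},\\ C&=a;(b^{\smile})^2\cdot b;a;a^{\smile}\cdot b^2;a^{\smile};b^{\smile},\qquad \pi_0=a;a^{\smile};b^{\smile}\cdot b;a;a^{\smile}\cdot b^2;(b^{\smile})^2 . \end{align*} Then: (i) $K$, $L$, $U$, $U^{\smile}$ are functional elements of $\mathfrak A$; (ii) $P$, $P_0$, $R$, $R_0$, $A$, $B$, $C$, $\pi_0$ are permutational elements of $\mathfrak A$; (iii) with $X_2=A;B;A^{\smile}$, $X_3=A^2;B;(A^{\smile})^2$, $C_2=B;C;A^{\smile}$, $C_3=B^2;C;(A^{\smile})^2$, $\pi_1=C_2;\pi_0;C_2^{\smile}$, $\pi_2=A;\pi_1;A^{\smile}$, $\pi_3=A^2;\pi_1;(A^{\smile})^2$ and $[X,Y]=X;Y;X^{\smile};Y^{\smile}$, the following fourteen relations hold in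 the group $\mathrm{Pm}(\mathfrak A)$: $[B^{\smile};A,X_2]=1'$, $[B^{\smile};A,X_3]=1'$, $C=C_2;B$, $X_2;C_2=C_3;B$, $A;C=C_2^2$, $C^3=1'$, $\pi_1^2=1'$, $\pi_3;\pi_1=\pi_1;\pi_3$, $(\pi_1;\pi_2)^3=1'$, $\pi_1;X_3=X_3;\pi_1$, $X_2;\pi_1=\pi_1;\pi_2;B$, $B;\pi_2=\pi_3;B$, $C_3;\pi_1=\pi_2;C_3$, $(C_2;\pi_1)^3=1'$; (iv) the subgroup of $\mathrm{Pm}(\mathfrak A)$ generated by $\{A,B\}$ is a homomorphic image of Thompson's group $\mathcal F$; (v) the subgroup of $\mathrm{Pm}(\mathfrak A)$ generated by $\{A,B,C\}$ is a homomorphic image of Thompson's group $\mathcal T$; (vi) the subgroup of $\mathrm{Pm}(\mathfrak A)$ generated by $\{A,B,C,\pi_0\}$ is a homomorphic image of Thompson's group $\mathcal V$; (vii) $\{P_0,R_0,K,U\}$ and $\{P,R,K,U\}$ generate the same submonoid of $\mathrm{Fn}(\mathfrak A)$; (viii) the relations for Thompson's monoid $\mathcal M$ hold in the monoid $\mathrm{Fn}(\mathfrak A)$, namely: $P;P=1'$, $(P;R)^3=(R;P)^3=1'$; and for all $x,y\in\mathrm{Fn}(\mathfrak A)$, writing $x_0=a;x;a^{\smile}\cdot b;b^{\smile}$ and $x_1=a;a^{\smile}\cdot b;x;b^{\smile}$: $x_0;y_1=y_1;x_0$, $x;U=U;x_0;x_1$, $x=U;x_0;x_1;K_0;L_1$;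 and $U;K=1'$, $U;L=1'$, $P_0;K;K=K;L$, $P_0;K;L=K;K$, $P_0;L=L$, $R_0;K;K;K=K;K$, $R_0;K;K;L=K;L;K$, $R_0;K;L=K;L;L$, $R_0;L=L$; (ix) the submonoid of $\mathrm{Fn}(\mathfrak A)$ generated by $\{P_0,R_0,K,U\}$ is a homomorphic image of Thompson's monoid $\mathcal M$.
   Context: A J-algebra is an algebra $\mathfrak A=\langle A,\cdot,0,1,;,{}^{\smile},1'\rangle$ with binary operations $\cdot$ (Boolean product) and $;$ (relative product), a unary operation ${}^{\smile}$ (converse) and constants $0,1,1'$, satisfying for all $x,y,z$: $x\cdot(y\cdot z)=(x\cdot y)\cdot z$, $x\cdot y=y\cdot x$, $x\cdot x=x$, $x;(y;z)=(x;y);z$, $x;1'=x$, $(x\cdot y);z=(x\cdot y);z\cdot y;z$, $x^{\smile\smile}=x$, $(x;y)^{\smile}=y^{\smile};x^{\smile}$, $(x\cdot y)^{\smile}=x^{\smile}\cdot y^{\smile}$, $x;y\cdot z=(z;y^{\smile}\cdot x);(y\cdot x^{\smile};z)\cdot z$, $0\cdot x=0$, $x\cdot 1=x$, $x;0=0$. Converse binds tightest, then $;$, then $\cdot$; $x^n$ is the $n$-fold relative product. $x\le y$ means $x\cdot y=x$. A relation algebra (Tarski) is an algebra $\langle A,+,\cdot,-,0,1,;,{}^{\smile},1'\rangle$ satisfying: $+$ commutative and associative, $-(-x+-y)+-(-x+y)=x$, $x;(y;z)=(x;y);z$, $(x+y);z=x;z+y;z$, $x;1'=x$, $x^{\smile\smile}=x$,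 $(x+y)^{\smile}=x^{\smile}+y^{\smile}$, $(x;y)^{\smile}=y^{\smile};x^{\smile}$, $x^{\smile};-(x;y)+-y=-y$, $x\cdot y=-(-x+-y)$, $1=1'+-1'$, $0=-1$. An element $x$ is functional if $x^{\smile};x\le 1'$ and permutational if $x;x^{\smile}=1'=x^{\smile};x$; $\mathrm{Fn}(\mathfrak A)=\langle\text{functional elements},;,1'\rangle$ is a monoid and $\mathrm{Pm}(\mathfrak A)=\langle\text{permutational elements},;,{}^{\smile},1'\rangle$ is a group. Thompson's groups are defined by presentations (group notation, juxtaposition = composition of functions): put $X_2=A^{-1}BA$, $X_3=A^{-2}BA^2$, $C_2=A^{-1}CB$, $C_3=A^{-2}CB^2$, $\pi_1=C_2^{-1}\pi_0C_2$, $\pi_2=A^{-1}\pi_1A$, $\pi_3=A^{-2}\pi_1A^2$, and consider relations (1) $[AB^{-1},X_2]=1$, (2) $[AB^{-1},X_3]=1$, (3) $C=BC_2$, (4) $C_2X_2=BC_3$, (5) $CA=C_2^2$, (6) $C^3=1$, (7) $\pi_1^2=1$, (8) $\pi_1\pi_3=\pi_3\pi_1$, (9) $(\pi_2\pi_1)^3=1$, (10) $X_3\pi_1=\pi_1X_3$, (11) $\pi_1X_2=B\pi_2\pi_1$, (12) $\pi_2B=B\pi_3$, (13) $\pi_1C_3=C_3\pi_2$, (14) $(\pi_1C_2)^3=1$. $\mathcal F$ is the group with generators $A,B$ and relations (1),(2); $\mathcal T$ has generators $A,B,C$ and relations (1)–(6); $\mathcal V$ has generators $A,B,C,\pi_0$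 and relations (1)–(14). Thompson's monoid $\mathcal M$ is the monoid (Thompson; Brin) generated by $K,L,U,P_0,R_0$ (with $P,R$ elements of it) whose defining relations are those listed in (viii) (composition read left to right), with $x,y$ ranging over all elements of $\mathcal M$ and $x_0,x_1$ the corresponding "deferments" of $x$. *)

theory Defs
  imports "HOL-Algebra.Generated_Groups"
begin

record 'a j_alg = "'a partial_object" +
  bprod :: "'a \<Rightarrow> 'a \<Rightarrow> 'a"  (infixl \<open>\<cdot>\<index>\<close> 70)
  bzero :: 'a  (\<open>\<^bold>0\<index>\<close>)
  bone  :: 'a  (\<open>\<^bold>1\<index>\<close>)
  rprod :: "'a \<Rightarrow> 'a \<Rightarrow> 'a"  (infixl \<open>\<Zcomp>\<index>\<close> 75)
  rconv :: "'a \<Rightarrow> 'a"  (\<open>(_\<^sup>\<smile>\<index>)\<close> [1000] 1000)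
  rid   :: 'a  (\<open>\<^bold>1''\<index>\<close>)

locale j_algebra =
  fixes \<AA> :: "('a, 'm) j_alg_scheme" (structure)
  assumes bprod_closed: "x \<in> carrier \<AA> \<Longrightarrow> y \<in> carrier \<AA> \<Longrightarrow> x \<cdot> y \<in> carrier \<AA>"
    and bzero_closed: "\<^bold>0 \<in> carrier \<AA>"
    and bone_closed: "\<^bold>1 \<in> carrier \<AA>"
    and rprod_closed: "x \<in> carrier \<AA> \<Longrightarrow> y \<in> carrier \<AA> \<Longrightarrow> x \<Zcomp> y \<in> carrier \<AA>"
    and rconv_closed: "x \<in> carrier \<AA> \<Longrightarrow> x\<^sup>\<smile> \<in> carrier \<AA>"
    and rid_closed: "\<^bold>1' \<in> carrier \<AA>"
    and bprod_assoc: "\<lbrakk>x \<in> carrier \<AA>; y \<in> carrier \<AA>; z \<in> carrier \<AA>\<rbrakk>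
          \<Longrightarrow> x \<cdot> (y \<cdot> z) = (x \<cdot> y) \<cdot> z"
    and bprod_comm: "\<lbrakk>x \<in> carrier \<AA>; y \<in> carrier \<AA>\<rbrakk> \<Longrightarrow> x \<cdot> y = y \<cdot> x"
    and bprod_idem: "x \<in> carrier \<AA> \<Longrightarrow> x \<cdot> x = x"
    and rprod_assoc: "\<lbrakk>x \<in> carrier \<AA>; y \<in> carrier \<AA>; z \<in> carrier \<AA>\<rbrakk>
          \<Longrightarrow> x \<Zcomp> (y \<Zcomp> z) = (x \<Zcomp> y) \<Zcomp> z"
    and rprod_rid: "x \<in> carrier \<AA> \<Longrightarrow> x \<Zcomp> \<^bold>1' = x"
    and rprod_mono: "\<lbrakk>x \<in> carrier \<AA>; y \<in> carrier \<AA>; z \<in> carrier \<AA>\<rbrakk>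
          \<Longrightarrow> (x \<cdot> y) \<Zcomp> z = (x \<cdot> y) \<Zcomp> z \<cdot> y \<Zcomp> z"
    and rconv_rconv: "x \<in> carrier \<AA> \<Longrightarrow> x\<^sup>\<smile>\<^sup>\<smile> = x"
    and rconv_rprod: "\<lbrakk>x \<in> carrier \<AA>; y \<in> carrier \<AA>\<rbrakk> \<Longrightarrow> (x \<Zcomp> y)\<^sup>\<smile> = y\<^sup>\<smile> \<Zcomp> x\<^sup>\<smile>"
    and rconv_bprod: "\<lbrakk>x \<in> carrier \<AA>; y \<in> carrier \<AA>\<rbrakk> \<Longrightarrow> (x \<cdot> y)\<^sup>\<smile> = x\<^sup>\<smile> \<cdot> y\<^sup>\<smile>"
    and rotation: "\<lbrakk>x \<in> carrier \<AA>; y \<in> carrier \<AA>; z \<in> carrier \<AA>\<rbrakk>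
          \<Longrightarrow> x \<Zcomp> y \<cdot> z = (z \<Zcomp> y\<^sup>\<smile> \<cdot> x) \<Zcomp> (y \<cdot> x\<^sup>\<smile> \<Zcomp> z) \<cdot> z"
    and bzero_bprod: "x \<in> carrier \<AA> \<Longrightarrow> \<^bold>0 \<cdot> x = \<^bold>0"
    and bprod_bone: "x \<in> carrier \<AA> \<Longrightarrow> x \<cdot> \<^bold>1 = x"
    and rprod_bzero: "x \<in> carrier \<AA> \<Longrightarrow> x \<Zcomp> \<^bold>0 = \<^bold>0"

text \<open>The operations of a relation algebra that are absent from the signature of J-algebras,
  Boolean sum and complement, are separate parameters.\<close>

locale relation_algebra =
  fixes \<AA> :: "('a, 'm) j_alg_scheme" (structure)
    and bsum :: "'a \<Rightarrow> 'a \<Rightarrow> 'a"  (infixl \<open>\<^bold>+\<close> 65)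
    and bcompl :: "'a \<Rightarrow> 'a"  (\<open>\<sim>_\<close> [81] 80)
  assumes bsum_closed: "x \<in> carrier \<AA> \<Longrightarrow> y \<in> carrier \<AA> \<Longrightarrow> x \<^bold>+ y \<in> carrier \<AA>"
    and bprod_closed: "x \<in> carrier \<AA> \<Longrightarrow> y \<in> carrier \<AA> \<Longrightarrow> x \<cdot> y \<in> carrier \<AA>"
    and bcompl_closed: "x \<in> carrier \<AA> \<Longrightarrow> \<sim>x \<in> carrier \<AA>"
    and bzero_closed: "\<^bold>0 \<in> carrier \<AA>"
    and bone_closed: "\<^bold>1 \<in> carrier \<AA>"
    and rprod_closed: "x \<in> carrier \<AA> \<Longrightarrow> y \<in> carrier \<AA> \<Longrightarrow> x \<Zcomp> y \<in> carrier \<AA>"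
    and rconv_closed: "x \<in> carrier \<AA> \<Longrightarrow> x\<^sup>\<smile> \<in> carrier \<AA>"
    and rid_closed: "\<^bold>1' \<in> carrier \<AA>"
    and bsum_comm: "\<lbrakk>x \<in> carrier \<AA>; y \<in> carrier \<AA>\<rbrakk> \<Longrightarrow> x \<^bold>+ y = y \<^bold>+ x"
    and bsum_assoc: "\<lbrakk>x \<in> carrier \<AA>; y \<in> carrier \<AA>; z \<in> carrier \<AA>\<rbrakk>
          \<Longrightarrow> x \<^bold>+ (y \<^bold>+ z) = (x \<^bold>+ y) \<^bold>+ z"
    and huntington: "\<lbrakk>x \<in> carrier \<AA>; y \<in> carrier \<AA>\<rbrakk>
          \<Longrightarrow> \<sim>(\<sim>x \<^bold>+ \<sim>y) \<^bold>+ \<sim>(\<sim>x \<^bold>+ y) = x"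
    and rprod_assoc: "\<lbrakk>x \<in> carrier \<AA>; y \<in> carrier \<AA>; z \<in> carrier \<AA>\<rbrakk>
          \<Longrightarrow> x \<Zcomp> (y \<Zcomp> z) = (x \<Zcomp> y) \<Zcomp> z"
    and rprod_bsum: "\<lbrakk>x \<in> carrier \<AA>; y \<in> carrier \<AA>; z \<in> carrier \<AA>\<rbrakk>
          \<Longrightarrow> (x \<^bold>+ y) \<Zcomp> z = x \<Zcomp> z \<^bold>+ y \<Zcomp> z"
    and rprod_rid: "x \<in> carrier \<AA> \<Longrightarrow> x \<Zcomp> \<^bold>1' = x"
    and rconv_rconv: "x \<in> carrier \<AA> \<Longrightarrow> x\<^sup>\<smile>\<^sup>\<smile> = x"
    and rconv_bsum: "\<lbrakk>x \<in> carrier \<AA>; y \<in> carrier \<AA>\<rbrakk> \<Longrightarrow> (x \<^bold>+ y)\<^sup>\<smile> = x\<^sup>\<smile> \<^bold>+ y\<^sup>\<smile>"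
    and rconv_rprod: "\<lbrakk>x \<in> carrier \<AA>; y \<in> carrier \<AA>\<rbrakk> \<Longrightarrow> (x \<Zcomp> y)\<^sup>\<smile> = y\<^sup>\<smile> \<Zcomp> x\<^sup>\<smile>"
    and tarski: "\<lbrakk>x \<in> carrier \<AA>; y \<in> carrier \<AA>\<rbrakk>
          \<Longrightarrow> x\<^sup>\<smile> \<Zcomp> \<sim>(x \<Zcomp> y) \<^bold>+ \<sim>y = \<sim>y"
    and bprod_eq: "\<lbrakk>x \<in> carrier \<AA>; y \<in> carrier \<AA>\<rbrakk> \<Longrightarrow> x \<cdot> y = \<sim>(\<sim>x \<^bold>+ \<sim>y)"
    and bone_eq: "\<^bold>1 = \<^bold>1' \<^bold>+ \<sim>\<^bold>1'"
    and bzero_eq: "\<^bold>0 = \<sim>\<^bold>1"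

definition rle :: "('a, 'm) j_alg_scheme \<Rightarrow> 'a \<Rightarrow> 'a \<Rightarrow> bool"  (infix \<open>\<preceq>\<index>\<close> 50)
  where "x \<preceq>\<^bsub>\<AA>\<^esub> y \<longleftrightarrow> x \<cdot>\<^bsub>\<AA>\<^esub> y = x"

definition functional :: "('a, 'm) j_alg_scheme \<Rightarrow> 'a \<Rightarrow> bool"
  where "functional \<AA> x \<longleftrightarrow> x \<in> carrier \<AA> \<and> x\<^sup>\<smile>\<^bsub>\<AA>\<^esub> \<Zcomp>\<^bsub>\<AA>\<^esub> x \<preceq>\<^bsub>\<AA>\<^esub> \<^bold>1'\<^bsub>\<AA>\<^esub>"

definition permutational :: "('a, 'm) j_alg_scheme \<Rightarrow> 'a \<Rightarrow> bool"
  where "permutational \<AA> x \<longleftrightarrow> x \<in> carrier \<AA> \<and>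
    x \<Zcomp>\<^bsub>\<AA>\<^esub> x\<^sup>\<smile>\<^bsub>\<AA>\<^esub> = \<^bold>1'\<^bsub>\<AA>\<^esub> \<and> x\<^sup>\<smile>\<^bsub>\<AA>\<^esub> \<Zcomp>\<^bsub>\<AA>\<^esub> x = \<^bold>1'\<^bsub>\<AA>\<^esub>"

definition Fn :: "('a, 'm) j_alg_scheme \<Rightarrow> 'a monoid"
  where "Fn \<AA> = \<lparr>carrier = {x. functional \<AA> x}, mult = rprod \<AA>, one = rid \<AA>\<rparr>"

definition Pm :: "('a, 'm) j_alg_scheme \<Rightarrow> 'a monoid"
  where "Pm \<AA> = \<lparr>carrier = {x. permutational \<AA> x}, mult = rprod \<AA>, one = rid \<AA>\<rparr>"

definition submonoid_generated :: "('a, 'b) monoid_scheme \<Rightarrow> 'a set \<Rightarrow> ('a, 'b) monoid_scheme"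
  where "submonoid_generated G S =
    G\<lparr>carrier := \<Inter>{H. submonoid H G \<and> carrier G \<inter> S \<subseteq> H}\<rparr>"

definition group_image :: "('a, 'b) monoid_scheme \<Rightarrow> ('c, 'd) monoid_scheme \<Rightarrow> bool"
  where "group_image H G \<longleftrightarrow> (\<exists>h. h \<in> epi G H)"

definition monoid_image :: "('a, 'b) monoid_scheme \<Rightarrow> ('c, 'd) monoid_scheme \<Rightarrow> bool"
  where "monoid_image H G \<longleftrightarrow> (\<exists>h. h \<in> epi G H \<and> h \<one>\<^bsub>G\<^esub> = \<one>\<^bsub>H\<^esub>)"

inductive pcong :: "'l set \<Rightarrow> ('l list \<times> 'l list) set \<Rightarrow> 'l list \<Rightarrow> 'l list \<Rightarrow> bool"
  for S :: "'l set" and R :: "('l list \<times> 'l list) set"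
  where
    cong_rel: "(u, v) \<in> R \<Longrightarrow> pcong S R u v"
  | cong_refl: "u \<in> lists S \<Longrightarrow> pcong S R u u"
  | cong_sym: "pcong S R u v \<Longrightarrow> pcong S R v u"
  | cong_trans: "pcong S R u v \<Longrightarrow> pcong S R v w \<Longrightarrow> pcong S R u w"
  | cong_app: "pcong S R u u' \<Longrightarrow> pcong S R v v' \<Longrightarrow> pcong S R (u @ v) (u' @ v')"

definition presented_monoid :: "'l set \<Rightarrow> ('l list \<times> 'l list) set \<Rightarrow> 'l list set monoid"
  where "presented_monoid S R =
    \<lparr>carrier = lists S // {(u, v). pcong S R u v},
     mult = (\<lambda>X Y. \<Union>u\<in>X. \<Union>v\<in>Y. {w. pcong S R (u @ v) w}),
     one = {w. pcong S R [] w}\<rparr>"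

text \<open>Letters \<open>(g, True)\<close> and \<open>(g, False)\<close> stand for a generator \<open>g\<close> and its inverse.\<close>

definition presented_group ::
    "'g set \<Rightarrow> (('g \<times> bool) list \<times> ('g \<times> bool) list) set \<Rightarrow> ('g \<times> bool) list set monoid"
  where "presented_group S R = presented_monoid (S \<times> UNIV)
    (R \<union> {([(g, e), (g, \<not> e)], []) | g e. g \<in> S})"

definition winv :: "('g \<times> bool) list \<Rightarrow> ('g \<times> bool) list"
  where "winv w = rev (map (\<lambda>(g, e). (g, \<not> e)) w)"

definition wcomm :: "('g \<times> bool) list \<Rightarrow> ('g \<times> bool) list \<Rightarrow> ('g \<times> bool) list"
  where "wcomm v w = v @ w @ winv v @ winv w"

datatype tgen = GA | GB | GC | GPi

definition "wA = [(GA, True)]"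
definition "wB = [(GB, True)]"
definition "wC = [(GC, True)]"
definition "wPi0 = [(GPi, True)]"
definition "wX2 = winv wA @ wB @ wA"
definition "wX3 = winv wA @ winv wA @ wB @ wA @ wA"
definition "wC2 = winv wA @ wC @ wB"
definition "wC3 = winv wA @ winv wA @ wC @ wB @ wB"
definition "wPi1 = winv wC2 @ wPi0 @ wC2"
definition "wPi2 = winv wA @ wPi1 @ wA"
definition "wPi3 = winv wA @ winv wA @ wPi1 @ wA @ wA"

definition F_relations :: "((tgen \<times> bool) list \<times> (tgen \<times> bool) list) set"
  where "F_relations =
    {(wcomm (wA @ winv wB) wX2, []),
     (wcomm (wA @ winv wB) wX3, [])}"

definition T_relations :: "((tgen \<times> bool) list \<times> (tgen \<times> bool) list) set"
  where "T_relations = F_relations \<union>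
    {(wC, wB @ wC2),
     (wC2 @ wX2, wB @ wC3),
     (wC @ wA, wC2 @ wC2),
     (wC @ wC @ wC, [])}"

definition V_relations :: "((tgen \<times> bool) list \<times> (tgen \<times> bool) list) set"
  where "V_relations = T_relations \<union>
    {(wPi1 @ wPi1, []),
     (wPi1 @ wPi3, wPi3 @ wPi1),
     ((wPi2 @ wPi1) @ (wPi2 @ wPi1) @ (wPi2 @ wPi1), []),
     (wX3 @ wPi1, wPi1 @ wX3),
     (wPi1 @ wX2, wB @ wPi2 @ wPi1),
     (wPi2 @ wB, wB @ wPi3),
     (wPi1 @ wC3, wC3 @ wPi2),
     ((wPi1 @ wC2) @ (wPi1 @ wC2) @ (wPi1 @ wC2), [])}"

definition "thompson_F = presented_group {GA, GB} F_relations"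
definition "thompson_T = presented_group {GA, GB, GC} T_relations"
definition "thompson_V = presented_group {GA, GB, GC, GPi} V_relations"

datatype mgen = gK | gL | gU | gP0 | gR0

definition mP :: "mgen list" where "mP = [gU, gP0, gK]"
definition mR :: "mgen list" where "mR = [gU, gR0, gK]"

text \<open>The inverse of \<open>R\<close>, by \<open>P\<^sup>2 = (PR)\<^sup>3 = (RP)\<^sup>3 = 1\<close>.\<close>

definition mRi :: "mgen list" where "mRi = mP @ mR @ mP @ mR @ mP"

text \<open>With \<open>K\<close> and \<open>L\<close> read as the two projections, the deferments of \<open>x\<close> are \<open>x\<close> acting on one
  coordinate: \<open>x\<^sub>0K = Kx\<close>, \<open>x\<^sub>0L = L\<close>, \<open>x\<^sub>1K = K\<close>, \<open>x\<^sub>1L = Lx\<close>.  They are compositional and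
  \<open>x\<^sub>1 = Px\<^sub>0P\<close>, so only \<open>x\<^sub>0\<close> for the five generators has to be written as a word.  For example,
  \<open>U\<^sub>0 = UK\<^sub>0R\<close> takes \<open>(p, q)\<close> via \<open>((p, q), (p, q))\<close> and \<open>(p, (p, q))\<close> to \<open>((p, p), q)\<close>.  The lemmas at
  the end of the theory show that in the monoid these words satisfy the four laws, that the laws
  determine them, and that the deferments of \<open>P\<close> and \<open>R\<close> are the generators \<open>P\<^sub>0\<close> and \<open>R\<^sub>0\<close>.\<close>

definition mK0 :: "mgen list" where "mK0 = mRi @ mP @ mRi @ [gL] @ mP"

fun gdefer0 :: "mgen \<Rightarrow> mgen list" where
  "gdefer0 gK = mK0"
| "gdefer0 gL = mRi @ [gL]"
| "gdefer0 gU = [gU] @ mK0 @ mR"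
| "gdefer0 gP0 = mRi @ [gP0] @ mR"
| "gdefer0 gR0 = mRi @ [gR0] @ mR"

definition defer0 :: "mgen list \<Rightarrow> mgen list" where "defer0 w = concat (map gdefer0 w)"
definition defer1 :: "mgen list \<Rightarrow> mgen list" where "defer1 w = mP @ defer0 w @ mP"

definition M_schemes :: "(mgen list \<times> mgen list) set"
  where "M_schemes =
    {(mP @ mP, []),
     ((mP @ mR) @ (mP @ mR) @ (mP @ mR), []),
     ((mR @ mP) @ (mR @ mP) @ (mR @ mP), [])} \<union>
    {(defer0 x @ defer1 y, defer1 y @ defer0 x) | x y. True} \<union>
    {(x @ [gU], [gU] @ defer0 x @ defer1 x) | x. True} \<union>
    {(x, [gU] @ defer0 x @ defer1 x @ defer0 [gK] @ defer1 [gL]) | x. True} \<union>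
    {([gU, gK], []),
     ([gU, gL], []),
     ([gP0, gK, gK], [gK, gL]),
     ([gP0, gK, gL], [gK, gK]),
     ([gP0, gL], [gL]),
     ([gR0, gK, gK, gK], [gK, gK]),
     ([gR0, gK, gK, gL], [gK, gL, gK]),
     ([gR0, gK, gL], [gK, gL, gL]),
     ([gR0, gL], [gL])}"

text \<open>The deferments are operations on the elements of the monoid, hence must agree on words that
  represent the same element: the relations are closed under deferment.\<close>

inductive_set M_relations :: "(mgen list \<times> mgen list) set" where
  scheme: "r \<in> M_schemes \<Longrightarrow> r \<in> M_relations"
| deferred: "(u, v) \<in> M_relations \<Longrightarrow> (defer0 u, defer0 v) \<in> M_relations"

definition "thompson_M = presented_monoid UNIV M_relations"

abbreviation mcong :: "mgen list \<Rightarrow> mgen list \<Rightarrow> bool"  (infix \<open>\<approx>\<close> 50)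
  where "u \<approx> v \<equiv> pcong UNIV M_relations u v"

context
begin

private lemma mrefl: "u \<approx> u"
  by (simp add: pcong.cong_refl)

private lemma scheme_cong: "(u, v) \<in> M_schemes \<Longrightarrow> u \<approx> v"
  by (intro pcong.cong_rel M_relations.scheme)

private lemma cong_left: "u \<approx> u' \<Longrightarrow> u @ v \<approx> u' @ v"
  by (intro pcong.cong_app mrefl)

private lemma cong_right: "v \<approx> v' \<Longrightarrow> u @ v \<approx> u @ v'"
  by (intro pcong.cong_app mrefl)

private lemma defer0_app: "defer0 (u @ v) = defer0 u @ defer0 v"
  by (simp add: defer0_def)

lemma defer0_cong: "u \<approx> v \<Longrightarrow> defer0 u \<approx> defer0 v"
proof (induction rule: pcong.induct)
  case (cong_rel u v)
  then show ?case by (intro pcong.cong_rel M_relations.deferred)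
next
  case (cong_app u u' v v')
  then show ?case by (simp add: defer0_app pcong.cong_app)
qed (auto intro: mrefl pcong.cong_sym pcong.cong_trans)

lemma defer1_cong: "u \<approx> v \<Longrightarrow> defer1 u \<approx> defer1 v"
  unfolding defer1_def by (rule cong_right[OF cong_left[OF defer0_cong]])

private definition cls :: "mgen list \<Rightarrow> mgen list set" where "cls u = {v. u \<approx> v}"

private lemma cls_eq: "cls u = cls v \<longleftrightarrow> u \<approx> v"
  unfolding cls_def using mrefl pcong.cong_sym pcong.cong_trans by blast

private definition act :: "mgen list \<Rightarrow> mgen list set \<Rightarrow> mgen list set"
  where "act u X = (\<Union>v\<in>X. cls (u @ v))"

private lemma act_cls: "act u (cls v) = cls (u @ v)"
proof -
  have "cls (u @ w) = cls (u @ v)" if "w \<in> cls v" for w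
    using that unfolding cls_eq by (auto simp: cls_def intro: cong_right pcong.cong_sym)
  moreover have "v \<in> cls v" by (simp add: cls_def mrefl)
  ultimately show ?thesis unfolding act_def by blast
qed

private lemma schemeI: "(u, v) \<in> M_schemes \<Longrightarrow> cls (u @ p) = cls (v @ p)"
  unfolding cls_eq by (intro cong_left scheme_cong)

private lemma act_append: "act (u @ v) (cls w) = act u (act v (cls w))"
  by (simp add: act_cls)

private lemma gen_steps:
  "cls (gU # gK # p) = cls p"
  "cls (gU # gL # p) = cls p"
  "cls (gP0 # gK # gK # p) = cls (gK # gL # p)"
  "cls (gP0 # gK # gL # p) = cls (gK # gK # p)"
  "cls (gP0 # gL # p) = cls (gL # p)"
  "cls (gR0 # gK # gK # gK # p) = cls (gK # gK # p)"
  "cls (gR0 # gK # gK # gL # p) = cls (gK # gL # gK # p)"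
  "cls (gR0 # gK # gL # p) = cls (gK # gL # gL # p)"
  "cls (gR0 # gL # p) = cls (gL # p)"
  using schemeI[of "[gU, gK]" "[]" p] schemeI[of "[gU, gL]" "[]" p]
    schemeI[of "[gP0, gK, gK]" "[gK, gL]" p] schemeI[of "[gP0, gK, gL]" "[gK, gK]" p]
    schemeI[of "[gP0, gL]" "[gL]" p]
    schemeI[of "[gR0, gK, gK, gK]" "[gK, gK]" p] schemeI[of "[gR0, gK, gK, gL]" "[gK, gL, gK]" p]
    schemeI[of "[gR0, gK, gL]" "[gK, gL, gL]" p] schemeI[of "[gR0, gL]" "[gL]" p]
  by (simp_all add: M_schemes_def)

private lemma cong_in: "cls v = cls v' \<Longrightarrow> cls (u @ v) = cls (u @ v')"
  unfolding cls_eq by (rule cong_right)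

private lemma PR_steps:
  "cls (mP @ gK # p) = cls (gL # p)"
  "cls (mP @ gL # p) = cls (gK # p)"
  "cls (mR @ gK # gK # p) = cls (gK # p)"
  "cls (mR @ gK # gL # p) = cls (gL # gK # p)"
  "cls (mR @ gL # p) = cls (gL # gL # p)"
  using cong_in[of "gP0 # gK # gK # p" "gK # gL # p" "[gU]"]
    cong_in[of "gP0 # gK # gL # p" "gK # gK # p" "[gU]"]
    cong_in[of "gR0 # gK # gK # gK # p" "gK # gK # p" "[gU]"]
    cong_in[of "gR0 # gK # gK # gL # p" "gK # gL # gK # p" "[gU]"]
    cong_in[of "gR0 # gK # gL # p" "gK # gL # gL # p" "[gU]"]
  by (simp_all add: mP_def mR_def gen_steps)

private lemma PP: "cls (mP @ mP @ p) = cls p"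
  using schemeI[of "mP @ mP" "[]" p] by (simp add: M_schemes_def)

private lemma RiR: "cls (mRi @ mR @ p) = cls p"
  using schemeI[of "(mP @ mR) @ (mP @ mR) @ (mP @ mR)" "[]" p]
  by (simp add: M_schemes_def mRi_def)

private lemma Ri_steps:
  "cls (mRi @ gK # p) = cls (gK # gK # p)"
  "cls (mRi @ gL # gK # p) = cls (gK # gL # p)"
  "cls (mRi @ gL # gL # p) = cls (gL # p)"
  using cong_in[OF PR_steps(3), of mRi p] cong_in[OF PR_steps(4), of mRi p]
    cong_in[OF PR_steps(5), of mRi p]
  by (simp_all add: RiR)

private lemma defer1_app: "defer1 (u @ v) \<approx> defer1 u @ defer1 v"
  using cong_in[OF PP[symmetric], of "mP @ defer0 u" "defer0 v @ mP"]
  by (simp add: defer1_def defer0_app cls_eq)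

private lemma pairing: "z \<approx> [gU] @ defer0 (z @ [gK]) @ defer1 (z @ [gL])"
proof -
  have "(z, [gU] @ defer0 z @ defer1 z @ defer0 [gK] @ defer1 [gL]) \<in> M_schemes"
    unfolding M_schemes_def by (intro UnI1[OF UnI2] CollectI exI[of _ z] conjI refl TrueI)
  then have 1: "z \<approx> [gU] @ defer0 z @ (defer1 z @ defer0 [gK]) @ defer1 [gL]"
    unfolding append_assoc by (rule scheme_cong)
  have "(defer0 [gK] @ defer1 z, defer1 z @ defer0 [gK]) \<in> M_schemes"
    unfolding M_schemes_def by (intro UnI1[OF UnI1[OF UnI1[OF UnI2]]] CollectI exI[of _ "[gK]"] exI[of _ z]
        conjI refl TrueI)
  then have "defer0 [gK] @ defer1 z \<approx> defer1 z @ defer0 [gK]"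
    by (rule scheme_cong)
  then have "[gU] @ defer0 z @ (defer1 z @ defer0 [gK]) @ defer1 [gL] \<approx>
      [gU] @ defer0 z @ (defer0 [gK] @ defer1 z) @ defer1 [gL]"
    by (rule cong_right[OF cong_right[OF cong_left[OF pcong.cong_sym]]])
  from pcong.cong_trans[OF 1 this]
  have 2: "z \<approx> ([gU] @ defer0 (z @ [gK])) @ (defer1 z @ defer1 [gL])"
    by (simp add: defer0_app)
  have "([gU] @ defer0 (z @ [gK])) @ (defer1 z @ defer1 [gL]) \<approx>
      ([gU] @ defer0 (z @ [gK])) @ defer1 (z @ [gL])"
    by (rule cong_right[OF pcong.cong_sym[OF defer1_app]])
  from pcong.cong_trans[OF 2 this] show ?thesis by simp
qed

lemma projections_determine:
  assumes "z @ [gK] \<approx> z' @ [gK]" "z @ [gL] \<approx> z' @ [gL]"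
  shows "z \<approx> z'"
proof -
  have "[gU] @ defer0 (z @ [gK]) @ defer1 (z @ [gL]) \<approx>
      [gU] @ defer0 (z' @ [gK]) @ defer1 (z' @ [gL])"
    by (rule pcong.cong_app[OF mrefl pcong.cong_app[OF defer0_cong[OF assms(1)] defer1_cong[OF assms(2)]]])
  then show ?thesis using pairing pcong.cong_sym pcong.cong_trans by metis
qed

private lemma ext:
  assumes "cls (z @ [gK]) = cls (z' @ [gK])" "cls (z @ [gL]) = cls (z' @ [gL])"
  shows "cls z = cls z'"
  using assms projections_determine unfolding cls_eq by blast

private lemmas acts = gen_steps PR_steps Ri_steps

private lemma act_steps:
  "act [gU] (cls (gK # p)) = cls p"
  "act [gU] (cls (gL # p)) = cls p"
  "act [gP0] (cls (gK # gK # p)) = cls (gK # gL # p)"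
  "act [gP0] (cls (gK # gL # p)) = cls (gK # gK # p)"
  "act [gP0] (cls (gL # p)) = cls (gL # p)"
  "act [gR0] (cls (gK # gK # gK # p)) = cls (gK # gK # p)"
  "act [gR0] (cls (gK # gK # gL # p)) = cls (gK # gL # gK # p)"
  "act [gR0] (cls (gK # gL # p)) = cls (gK # gL # gL # p)"
  "act [gR0] (cls (gL # p)) = cls (gL # p)"
  "act mP (cls (gK # p)) = cls (gL # p)"
  "act mP (cls (gL # p)) = cls (gK # p)"
  "act mR (cls (gK # gK # p)) = cls (gK # p)"
  "act mR (cls (gK # gL # p)) = cls (gL # gK # p)"
  "act mR (cls (gL # p)) = cls (gL # gL # p)"
  "act mRi (cls (gK # p)) = cls (gK # gK # p)"
  "act mRi (cls (gL # gK # p)) = cls (gK # gL # p)"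
  "act mRi (cls (gL # gL # p)) = cls (gL # p)"
  "act [gL] (cls p) = cls (gL # p)"
  "act [gK] (cls p) = cls (gK # p)"
  by (simp_all add: act_cls acts)

private lemma K0_steps:
  "act mK0 (cls (gK # p)) = cls (gK # gK # p)"
  "act mK0 (cls (gL # p)) = cls (gL # p)"
  unfolding mK0_def by (simp_all only: act_append act_steps)

private lemma gdefer0_K: "act (gdefer0 g) (cls [gK]) = cls [gK, g]"
proof (cases g)
  case gK
  then show ?thesis by (simp only: gdefer0.simps K0_steps)
next
  case gL
  then show ?thesis unfolding gL gdefer0.simps by (simp only: act_append act_steps)
next
  case gU
  have *: "act ([gU] @ mK0 @ mR) (cls (gK # gK # p)) = cls (gK # p)"
    "act ([gU] @ mK0 @ mR) (cls (gK # gL # p)) = cls (gK # p)" for p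
    by (simp_all only: act_append act_steps K0_steps)
  have "cls (([gU] @ mK0 @ mR) @ [gK]) = cls [gK, gU]"
    by (rule ext) (use *[of "[]"] cong_in[OF gen_steps(1), of "[gK]" "[]"]
        cong_in[OF gen_steps(2), of "[gK]" "[]"] in \<open>simp_all add: act_cls\<close>)
  then show ?thesis unfolding gU gdefer0.simps act_cls .
next
  case gP0
  have *: "act (mRi @ [gP0] @ mR) (cls (gK # gK # gK # p)) = cls (gK # gK # gL # p)"
    "act (mRi @ [gP0] @ mR) (cls (gK # gK # gL # p)) = cls (gK # gK # gK # p)"
    "act (mRi @ [gP0] @ mR) (cls (gK # gL # p)) = cls (gK # gL # p)" for p
    by (simp_all only: act_append act_steps)
  have 1: "cls (((mRi @ [gP0] @ mR) @ [gK]) @ [gK]) = cls ([gK, gP0] @ [gK])"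
    by (rule ext) (use *[of "[]"] cong_in[OF gen_steps(3), of "[gK]" "[]"]
        cong_in[OF gen_steps(4), of "[gK]" "[]"] in \<open>simp_all add: act_cls\<close>)
  have "cls ((mRi @ [gP0] @ mR) @ [gK]) = cls [gK, gP0]"
    by (rule ext[OF 1]) (use *[of "[]"] cong_in[OF gen_steps(5), of "[gK]" "[]"]
        in \<open>simp add: act_cls\<close>)
  then show ?thesis unfolding gP0 gdefer0.simps act_cls .
next
  case gR0
  have *: "act (mRi @ [gR0] @ mR) (cls (gK # gK # gK # gK # p)) = cls (gK # gK # gK # p)"
    "act (mRi @ [gR0] @ mR) (cls (gK # gK # gK # gL # p)) = cls (gK # gK # gL # gK # p)"
    "act (mRi @ [gR0] @ mR) (cls (gK # gK # gL # p)) = cls (gK # gK # gL # gL # p)"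
    "act (mRi @ [gR0] @ mR) (cls (gK # gL # p)) = cls (gK # gL # p)" for p
    by (simp_all only: act_append act_steps)
  have 1: "cls ((((mRi @ [gR0] @ mR) @ [gK]) @ [gK]) @ [gK]) = cls (([gK, gR0] @ [gK]) @ [gK])"
    by (rule ext) (use *[of "[]"] cong_in[OF gen_steps(6), of "[gK]" "[]"]
        cong_in[OF gen_steps(7), of "[gK]" "[]"] in \<open>simp_all add: act_cls\<close>)
  have 2: "cls (((mRi @ [gR0] @ mR) @ [gK]) @ [gK]) = cls ([gK, gR0] @ [gK])"
    by (rule ext[OF 1]) (use *[of "[]"] cong_in[OF gen_steps(8), of "[gK]" "[]"]
        in \<open>simp add: act_cls\<close>)
  have "cls ((mRi @ [gR0] @ mR) @ [gK]) = cls [gK, gR0]"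
    by (rule ext[OF 2]) (use *[of "[]"] cong_in[OF gen_steps(9), of "[gK]" "[]"]
        in \<open>simp add: act_cls\<close>)
  then show ?thesis unfolding gR0 gdefer0.simps act_cls .
qed

private lemma gdefer0_L: "act (gdefer0 g) (cls [gL]) = cls [gL]"
  by (cases g) (simp_all only: gdefer0.simps act_append act_steps K0_steps)

lemma defer0_K: "defer0 x @ [gK] \<approx> [gK] @ x"
proof (induction x)
  case (Cons g x)
  have "defer0 (g # x) @ [gK] = gdefer0 g @ (defer0 x @ [gK])"
    by (simp add: defer0_def)
  also have "\<dots> \<approx> gdefer0 g @ ([gK] @ x)"
    by (intro cong_right Cons.IH)
  finally have 1: "defer0 (g # x) @ [gK] \<approx> (gdefer0 g @ [gK]) @ x" by simp
  have "gdefer0 g @ [gK] \<approx> [gK, g]"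
    using gdefer0_K[of g] by (simp only: act_cls cls_eq)
  from pcong.cong_trans[OF 1 cong_left[OF this]] show ?case by simp
qed (simp add: defer0_def mrefl)

lemma defer0_L: "defer0 x @ [gL] \<approx> [gL]"
proof (induction x)
  case (Cons g x)
  have "defer0 (g # x) @ [gL] = gdefer0 g @ (defer0 x @ [gL])"
    by (simp add: defer0_def)
  also have "\<dots> \<approx> gdefer0 g @ [gL]"
    by (intro cong_right Cons.IH)
  finally have 1: "defer0 (g # x) @ [gL] \<approx> gdefer0 g @ [gL]" .
  have "gdefer0 g @ [gL] \<approx> [gL]"
    using gdefer0_L[of g] by (simp only: act_cls cls_eq)
  from pcong.cong_trans[OF 1 this] show ?case .
qed (simp add: defer0_def mrefl)

lemma defer1_K: "defer1 x @ [gK] \<approx> [gK]"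
proof -
  have "cls (defer1 x @ [gK]) = act mP (act (defer0 x) (act mP (cls [gK])))"
    by (simp add: defer1_def act_cls)
  also have "act (defer0 x) (act mP (cls [gK])) = cls [gL]"
    using defer0_L[of x] unfolding act_steps by (simp only: act_cls cls_eq)
  finally show ?thesis by (simp only: act_steps cls_eq)
qed

lemma defer1_L: "defer1 x @ [gL] \<approx> [gL] @ x"
proof -
  have "cls (defer1 x @ [gL]) = act mP (act (defer0 x) (act mP (cls [gL])))"
    by (simp add: defer1_def act_cls)
  also have "act (defer0 x) (act mP (cls [gL])) = cls ([gK] @ x)"
    using defer0_K[of x] unfolding act_steps by (simp only: act_cls cls_eq)
  finally show ?thesis by (simp add: act_steps cls_eq)
qed

lemma defer0_P: "defer0 mP \<approx> [gP0]"
proof (rule projections_determine)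
  have "cls ([gK] @ mP) = cls ([gP0] @ [gK])"
    by (rule ext) (use cong_in[OF PR_steps(1), of "[gK]" "[]"] cong_in[OF PR_steps(2), of "[gK]" "[]"]
        gen_steps(3,4)[of "[]"] in simp_all)
  then show "defer0 mP @ [gK] \<approx> [gP0] @ [gK]"
    using defer0_K[of mP] by (metis cls_eq)
  show "defer0 mP @ [gL] \<approx> [gP0] @ [gL]"
    using defer0_L[of mP] gen_steps(5)[of "[]"] by (metis cls_eq append_Cons append_Nil)
qed

lemma defer0_R: "defer0 mR \<approx> [gR0]"
proof (rule projections_determine)
  have 1: "cls (([gK] @ mR) @ [gK]) = cls (([gR0] @ [gK]) @ [gK])"
    by (rule ext) (use cong_in[OF PR_steps(3), of "[gK]" "[]"] cong_in[OF PR_steps(4), of "[gK]" "[]"]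
        gen_steps(6,7)[of "[]"] in simp_all)
  have "cls ([gK] @ mR) = cls ([gR0] @ [gK])"
    by (rule ext[OF 1]) (use cong_in[OF PR_steps(5), of "[gK]" "[]"] gen_steps(8)[of "[]"] in simp)
  then show "defer0 mR @ [gK] \<approx> [gR0] @ [gK]"
    using defer0_K[of mR] by (metis cls_eq)
  show "defer0 mR @ [gL] \<approx> [gR0] @ [gL]"
    using defer0_L[of mR] gen_steps(9)[of "[]"] by (metis cls_eq append_Cons append_Nil)
qed

end

end

theory Submission
  imports Defs
begin

text \<open>J-algebras and relation algebras are both one-object allegories with a greatest element, and
  the axioms of such allegories suffice.  Put \<open>fork x y = x;a\<^sup>\<smile> \<cdot> y;b\<^sup>\<smile>\<close>.  On mappings (total
  functional elements) \<open>a\<close>, \<open>b\<close> and \<open>fork\<close> satisfy the laws of surjective pairing: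
  \<open>fork x y;a = x\<close>, \<open>fork x y;b = y\<close>, \<open>z;fork x y = fork (z;x) (z;y)\<close> and
  \<open>fork (z;a) (z;b) = z\<close>.  Oriented from left to right they rewrite every product of the named
  elements to iterated forks of words in \<open>a\<close> and \<open>b\<close>, and each relation holds because both sides
  have the same normal form.  The laws for arbitrary functional \<open>x\<close>, where \<open>fork x y;a\<close> is only a
  restriction of \<open>x\<close>, reduce to \<open>fork x y;u\<^sub>0 = fork (x;u) y\<close> and
  \<open>fork x y;u\<^sub>1 = fork x (y;u)\<close>.  In (vii), \<open>R\<^sub>0\<close> lies in the submonoid generated by
  \<open>P, R, K, U\<close> because the mappings whose deferment lies there are closed under forks.\<close>

section \<open>Huntington algebras\<close>

locale huntington_algebra =
  fixes S :: "'a set"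
    and join :: "'a \<Rightarrow> 'a \<Rightarrow> 'a"  (infixl \<open>\<^bold>+\<close> 65)
    and compl :: "'a \<Rightarrow> 'a"  (\<open>\<sim>_\<close> [80] 80)
    and top :: 'a
  assumes join_closed [simp, intro]: "\<lbrakk>x \<in> S; y \<in> S\<rbrakk> \<Longrightarrow> x \<^bold>+ y \<in> S"
    and compl_closed [simp, intro]: "x \<in> S \<Longrightarrow> \<sim>x \<in> S"
    and join_comm: "\<lbrakk>x \<in> S; y \<in> S\<rbrakk> \<Longrightarrow> x \<^bold>+ y = y \<^bold>+ x"
    and join_assoc: "\<lbrakk>x \<in> S; y \<in> S; z \<in> S\<rbrakk> \<Longrightarrow> (x \<^bold>+ y) \<^bold>+ z = x \<^bold>+ (y \<^bold>+ z)"
    and huntington_eq: "\<lbrakk>x \<in> S; y \<in> S\<rbrakk> \<Longrightarrow> \<sim>(\<sim>x \<^bold>+ \<sim>y) \<^bold>+ \<sim>(\<sim>x \<^bold>+ y) = x"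
    and top_witness: "\<exists>x\<in>S. top = x \<^bold>+ \<sim>x"
begin

definition meet :: "'a \<Rightarrow> 'a \<Rightarrow> 'a"
  where "meet x y = \<sim>(\<sim>x \<^bold>+ \<sim>y)"

lemma join_left_comm: "\<lbrakk>x \<in> S; y \<in> S; z \<in> S\<rbrakk> \<Longrightarrow> x \<^bold>+ (y \<^bold>+ z) = y \<^bold>+ (x \<^bold>+ z)"
  by (metis join_assoc join_comm)

lemmas join_ac = join_assoc join_comm join_left_comm

lemma top_closed [simp, intro]: "top \<in> S"
  using top_witness by auto

lemma join_compl_unique:
  assumes [simp]: "x \<in> S" "y \<in> S"
  shows "x \<^bold>+ \<sim>x = y \<^bold>+ \<sim>y"
proof -
  have "x \<^bold>+ \<sim>x = (\<sim>(\<sim>x \<^bold>+ \<sim>\<sim>y) \<^bold>+ \<sim>(\<sim>x \<^bold>+ \<sim>y)) \<^bold>+ (\<sim>(\<sim>\<sim>x \<^bold>+ \<sim>\<sim>y) \<^bold>+ \<sim>(\<sim>\<sim>x \<^bold>+ \<sim>y))"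
    by (simp add: huntington_eq)
  also have "\<dots> = (\<sim>(\<sim>y \<^bold>+ \<sim>\<sim>x) \<^bold>+ \<sim>(\<sim>y \<^bold>+ \<sim>x)) \<^bold>+ (\<sim>(\<sim>\<sim>y \<^bold>+ \<sim>\<sim>x) \<^bold>+ \<sim>(\<sim>\<sim>y \<^bold>+ \<sim>x))"
    by (simp add: join_ac)
  also have "\<dots> = y \<^bold>+ \<sim>y"
    by (simp add: huntington_eq)
  finally show ?thesis .
qed

lemma join_compl: "x \<in> S \<Longrightarrow> x \<^bold>+ \<sim>x = top"
  using top_witness join_compl_unique by blast

lemma compl_compl [simp]:
  assumes [simp]: "x \<in> S"
  shows "\<sim>\<sim>x = x"
proof -
  have "\<sim>\<sim>x = \<sim>(\<sim>\<sim>\<sim>x \<^bold>+ \<sim>\<sim>x) \<^bold>+ \<sim>(\<sim>\<sim>\<sim>x \<^bold>+ \<sim>x)"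
    using huntington_eq[of "\<sim>\<sim>x" "\<sim>x"] by simp
  also have "\<dots> = \<sim>(\<sim>x \<^bold>+ \<sim>\<sim>\<sim>x) \<^bold>+ \<sim>(\<sim>x \<^bold>+ \<sim>\<sim>x)"
    using join_compl_unique[of "\<sim>x" "\<sim>\<sim>x"] by (simp add: join_comm)
  also have "\<dots> = x"
    by (simp add: huntington_eq)
  finally show ?thesis .
qed

lemma top_join_top: "top \<^bold>+ top = top"
proof -
  let ?c = "\<sim>(top \<^bold>+ top)"
  have top_bot: "top \<^bold>+ \<sim>top = top"
    by (simp add: join_compl)
  have "\<sim>top \<^bold>+ ?c = \<sim>top"
    using huntington_eq[of "\<sim>top" top] by (simp add: top_bot)
  then have "top \<^bold>+ ?c = top"
    using join_assoc[of top "\<sim>top" ?c] by (simp add: top_bot)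
  then have "top \<^bold>+ top = (top \<^bold>+ top) \<^bold>+ ?c"
    by (simp add: join_assoc)
  then show ?thesis
    by (simp add: join_compl)
qed

lemma join_compl_top:
  assumes [simp]: "x \<in> S"
  shows "x \<^bold>+ \<sim>top = x"
proof -
  let ?d = "\<sim>(\<sim>x \<^bold>+ \<sim>x)"
  have idem: "\<sim>top \<^bold>+ \<sim>top = \<sim>top"
    using huntington_eq[of "\<sim>top" top] by (simp add: join_compl top_join_top)
  have x: "?d \<^bold>+ \<sim>top = x"
    using huntington_eq[of x x] by (simp add: join_comm[of "\<sim>x" x] join_compl)
  then have "x \<^bold>+ \<sim>top = ?d \<^bold>+ (\<sim>top \<^bold>+ \<sim>top)"
    by (metis assms compl_closed join_assoc join_closed top_closed)
  then show ?thesis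
    by (simp add: idem x)
qed

lemma join_idem [simp]:
  assumes [simp]: "x \<in> S"
  shows "x \<^bold>+ x = x"
proof -
  have "\<sim>(x \<^bold>+ x) = \<sim>x"
    using huntington_eq[of "\<sim>x" "\<sim>x"] by (simp add: join_compl join_compl_top)
  then show ?thesis
    by (metis assms compl_compl join_closed)
qed

lemma join_left_idem [simp]: "\<lbrakk>x \<in> S; y \<in> S\<rbrakk> \<Longrightarrow> x \<^bold>+ (x \<^bold>+ y) = x \<^bold>+ y"
  by (simp flip: join_assoc)

lemma join_top: "x \<in> S \<Longrightarrow> x \<^bold>+ top = top"
  by (simp flip: join_compl[of x])

lemma meet_closed [simp, intro]: "\<lbrakk>x \<in> S; y \<in> S\<rbrakk> \<Longrightarrow> meet x y \<in> S"
  by (simp add: meet_def)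

lemma meet_comm: "\<lbrakk>x \<in> S; y \<in> S\<rbrakk> \<Longrightarrow> meet x y = meet y x"
  by (simp add: meet_def join_comm)

lemma meet_assoc: "\<lbrakk>x \<in> S; y \<in> S; z \<in> S\<rbrakk> \<Longrightarrow> meet x (meet y z) = meet (meet x y) z"
  by (simp add: meet_def join_assoc)

lemma meet_idem: "x \<in> S \<Longrightarrow> meet x x = x"
  by (simp add: meet_def)

lemma meet_join_meet_compl: "\<lbrakk>x \<in> S; y \<in> S\<rbrakk> \<Longrightarrow> meet x y \<^bold>+ meet x (\<sim>y) = x"
  by (simp add: meet_def huntington_eq)

lemma join_eq_iff_compl_join:
  assumes [simp]: "x \<in> S" "y \<in> S"
  shows "x \<^bold>+ y = y \<longleftrightarrow> \<sim>x \<^bold>+ y = top"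
proof
  assume "x \<^bold>+ y = y"
  then have "\<sim>x \<^bold>+ y = y \<^bold>+ (x \<^bold>+ \<sim>x)"
    by (metis assms compl_closed join_comm join_left_comm)
  then show "\<sim>x \<^bold>+ y = top"
    by (simp add: join_compl join_top)
next
  assume "\<sim>x \<^bold>+ y = top"
  then have "x = meet x y"
    using huntington_eq[of x y] by (simp add: join_compl_top meet_def)
  then have "y = x \<^bold>+ meet y (\<sim>x)"
    using meet_join_meet_compl[of y x] by (simp add: meet_comm)
  then show "x \<^bold>+ y = y"
    by (metis assms compl_closed join_left_idem meet_closed)
qed

lemma meet_eq_iff_join_eq:
  assumes [simp]: "x \<in> S" "y \<in> S"
  shows "meet x y = x \<longleftrightarrow> x \<^bold>+ y = y"
proof
  assume "meet x y = x"
  then show "x \<^bold>+ y = y"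
    by (metis assms compl_closed join_left_idem meet_closed meet_comm meet_join_meet_compl)
next
  assume "x \<^bold>+ y = y"
  then show "meet x y = x"
    using huntington_eq[of x y] by (simp add: join_eq_iff_compl_join join_compl_top meet_def)
qed

lemma meet_join_eq_iff_join_compl:
  assumes [simp]: "x \<in> S" "y \<in> S" "z \<in> S"
  shows "meet x y \<^bold>+ z = z \<longleftrightarrow> x \<^bold>+ (\<sim>y \<^bold>+ z) = \<sim>y \<^bold>+ z"
  by (simp add: join_eq_iff_compl_join meet_def join_assoc)

end

section \<open>Allegories\<close>

locale meet_semilattice =
  fixes \<AA> :: "('a, 'm) j_alg_scheme" (structure)
  assumes bprod_closed [simp, intro]: "\<lbrakk>x \<in> carrier \<AA>; y \<in> carrier \<AA>\<rbrakk> \<Longrightarrow> x \<cdot> y \<in> carrier \<AA>"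
    and bprod_assoc: "\<lbrakk>x \<in> carrier \<AA>; y \<in> carrier \<AA>; z \<in> carrier \<AA>\<rbrakk> \<Longrightarrow> x \<cdot> (y \<cdot> z) = (x \<cdot> y) \<cdot> z"
    and bprod_comm: "\<lbrakk>x \<in> carrier \<AA>; y \<in> carrier \<AA>\<rbrakk> \<Longrightarrow> x \<cdot> y = y \<cdot> x"
    and bprod_idem: "x \<in> carrier \<AA> \<Longrightarrow> x \<cdot> x = x"
begin

lemma bprod_left_comm:
  "\<lbrakk>x \<in> carrier \<AA>; y \<in> carrier \<AA>; z \<in> carrier \<AA>\<rbrakk> \<Longrightarrow> x \<cdot> (y \<cdot> z) = y \<cdot> (x \<cdot> z)"
  by (metis bprod_assoc bprod_comm)

lemmas bprod_ac = bprod_assoc[symmetric] bprod_comm bprod_left_comm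

lemma le_refl: "x \<in> carrier \<AA> \<Longrightarrow> x \<preceq> x"
  by (simp add: rle_def bprod_idem)

lemma le_trans:
  "\<lbrakk>x \<preceq> y; y \<preceq> z; x \<in> carrier \<AA>; y \<in> carrier \<AA>; z \<in> carrier \<AA>\<rbrakk> \<Longrightarrow> x \<preceq> z"
  unfolding rle_def by (metis bprod_assoc)

lemma le_antisym: "\<lbrakk>x \<preceq> y; y \<preceq> x; x \<in> carrier \<AA>; y \<in> carrier \<AA>\<rbrakk> \<Longrightarrow> x = y"
  unfolding rle_def by (metis bprod_comm)

lemma bprod_le_left: "\<lbrakk>x \<in> carrier \<AA>; y \<in> carrier \<AA>\<rbrakk> \<Longrightarrow> x \<cdot> y \<preceq> x"
  unfolding rle_def by (metis bprod_assoc bprod_comm bprod_idem)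

lemma bprod_le_right: "\<lbrakk>x \<in> carrier \<AA>; y \<in> carrier \<AA>\<rbrakk> \<Longrightarrow> x \<cdot> y \<preceq> y"
  unfolding rle_def by (metis bprod_assoc bprod_idem)

lemma le_bprodI:
  "\<lbrakk>z \<preceq> x; z \<preceq> y; x \<in> carrier \<AA>; y \<in> carrier \<AA>; z \<in> carrier \<AA>\<rbrakk> \<Longrightarrow> z \<preceq> x \<cdot> y"
  unfolding rle_def by (simp add: bprod_assoc)

lemma bprod_le_mono:
  assumes "x \<preceq> x'" "y \<preceq> y'"
    and [simp]: "x \<in> carrier \<AA>" "y \<in> carrier \<AA>" "x' \<in> carrier \<AA>" "y' \<in> carrier \<AA>"
  shows "x \<cdot> y \<preceq> x' \<cdot> y'"
  by (rule le_bprodI)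
    (auto intro: le_trans[OF bprod_le_left assms(1)] le_trans[OF bprod_le_right assms(2)])

lemma mono_involution_bprod:
  assumes closed [simp]: "\<And>x. x \<in> carrier \<AA> \<Longrightarrow> f x \<in> carrier \<AA>"
    and invol: "\<And>x. x \<in> carrier \<AA> \<Longrightarrow> f (f x) = x"
    and mono: "\<And>x y. \<lbrakk>x \<preceq> y; x \<in> carrier \<AA>; y \<in> carrier \<AA>\<rbrakk> \<Longrightarrow> f x \<preceq> f y"
    and [simp]: "x \<in> carrier \<AA>" "y \<in> carrier \<AA>"
  shows "f (x \<cdot> y) = f x \<cdot> f y"
proof -
  have le: "f (u \<cdot> v) \<preceq> f u \<cdot> f v" if "u \<in> carrier \<AA>" "v \<in> carrier \<AA>" for u v
    using that by (intro le_bprodI mono bprod_le_left bprod_le_right) auto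
  have "f (f x \<cdot> f y) \<preceq> x \<cdot> y"
    using le[of "f x" "f y"] by (simp add: invol)
  from mono[OF this] have "f x \<cdot> f y \<preceq> f (x \<cdot> y)"
    by (simp add: invol)
  with le show ?thesis
    by (intro le_antisym) auto
qed

end

text \<open>One-object allegories in the sense of Freyd and Scedrov, with a greatest element.\<close>

locale allegory = meet_semilattice +
  assumes bone_closed [simp, intro]: "\<^bold>1 \<in> carrier \<AA>"
    and rprod_closed [simp, intro]: "\<lbrakk>x \<in> carrier \<AA>; y \<in> carrier \<AA>\<rbrakk> \<Longrightarrow> x \<Zcomp> y \<in> carrier \<AA>"
    and rconv_closed [simp, intro]: "x \<in> carrier \<AA> \<Longrightarrow> x\<^sup>\<smile> \<in> carrier \<AA>"
    and rid_closed [simp, intro]: "\<^bold>1' \<in> carrier \<AA>"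
    and bprod_bone: "x \<in> carrier \<AA> \<Longrightarrow> x \<cdot> \<^bold>1 = x"
    and rprod_assoc: "\<lbrakk>x \<in> carrier \<AA>; y \<in> carrier \<AA>; z \<in> carrier \<AA>\<rbrakk> \<Longrightarrow> x \<Zcomp> (y \<Zcomp> z) = (x \<Zcomp> y) \<Zcomp> z"
    and rprod_rid [simp]: "x \<in> carrier \<AA> \<Longrightarrow> x \<Zcomp> \<^bold>1' = x"
    and bprod_rprod_le: "\<lbrakk>x \<in> carrier \<AA>; y \<in> carrier \<AA>; z \<in> carrier \<AA>\<rbrakk> \<Longrightarrow> (x \<cdot> y) \<Zcomp> z \<preceq> y \<Zcomp> z"
    and rconv_rconv [simp]: "x \<in> carrier \<AA> \<Longrightarrow> x\<^sup>\<smile>\<^sup>\<smile> = x"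
    and rconv_rprod: "\<lbrakk>x \<in> carrier \<AA>; y \<in> carrier \<AA>\<rbrakk> \<Longrightarrow> (x \<Zcomp> y)\<^sup>\<smile> = y\<^sup>\<smile> \<Zcomp> x\<^sup>\<smile>"
    and rconv_bprod: "\<lbrakk>x \<in> carrier \<AA>; y \<in> carrier \<AA>\<rbrakk> \<Longrightarrow> (x \<cdot> y)\<^sup>\<smile> = x\<^sup>\<smile> \<cdot> y\<^sup>\<smile>"
    and modular: "\<lbrakk>x \<in> carrier \<AA>; y \<in> carrier \<AA>; z \<in> carrier \<AA>\<rbrakk> \<Longrightarrow> x \<Zcomp> y \<cdot> z \<preceq> x \<Zcomp> (y \<cdot> x\<^sup>\<smile> \<Zcomp> z)"

theorem (in j_algebra) is_allegory: "allegory \<AA>"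
proof
  fix x y z assume [simp]: "x \<in> carrier \<AA>" "y \<in> carrier \<AA>" "z \<in> carrier \<AA>"
  note [simp] = bprod_closed rprod_closed rconv_closed
  show "(x \<cdot> y) \<Zcomp> z \<preceq> y \<Zcomp> z"
    by (simp add: rle_def rprod_mono[symmetric])
  let ?u = "z \<Zcomp> y\<^sup>\<smile> \<cdot> x" and ?v = "y \<cdot> x\<^sup>\<smile> \<Zcomp> z"
  have rotated: "x \<Zcomp> y \<cdot> z = ?u \<Zcomp> ?v \<cdot> z"
    by (rule rotation) auto
  have "(x \<Zcomp> y \<cdot> z) \<cdot> x \<Zcomp> ?v = (?u \<Zcomp> ?v \<cdot> x \<Zcomp> ?v) \<cdot> z"
    by (simp add: rotated bprod_assoc[symmetric] bprod_comm[of z])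
  also have "\<dots> = ?u \<Zcomp> ?v \<cdot> z"
    by (simp flip: rprod_mono)
  also have "\<dots> = x \<Zcomp> y \<cdot> z"
    by (rule rotated[symmetric])
  finally show "x \<Zcomp> y \<cdot> z \<preceq> x \<Zcomp> ?v"
    by (simp add: rle_def)
qed (rule bprod_closed bone_closed rprod_closed rconv_closed rid_closed bprod_assoc bprod_comm
    bprod_idem bprod_bone rprod_assoc rprod_rid rconv_rconv rconv_rprod rconv_bprod; assumption)+

context relation_algebra
begin

lemmas closed [simp, intro] =
  bsum_closed bprod_closed bcompl_closed bone_closed rprod_closed rconv_closed rid_closed

sublocale huntington_algebra "carrier \<AA>" bsum bcompl "\<^bold>1"
proof
  show "x \<^bold>+ y = y \<^bold>+ x" if "x \<in> carrier \<AA>" "y \<in> carrier \<AA>" for x y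
    using that by (rule bsum_comm)
qed (auto simp: bsum_assoc huntington bone_eq)

lemma bprod_eq_meet: "\<lbrakk>x \<in> carrier \<AA>; y \<in> carrier \<AA>\<rbrakk> \<Longrightarrow> x \<cdot> y = meet x y"
  by (simp add: bprod_eq meet_def)

sublocale meet_semilattice
proof
  show "x \<cdot> y = y \<cdot> x" if "x \<in> carrier \<AA>" "y \<in> carrier \<AA>" for x y
    using that by (simp add: bprod_eq_meet meet_comm)
qed (simp_all add: bprod_eq_meet meet_assoc meet_idem)

lemma le_iff_bsum: "\<lbrakk>x \<in> carrier \<AA>; y \<in> carrier \<AA>\<rbrakk> \<Longrightarrow> x \<preceq> y \<longleftrightarrow> x \<^bold>+ y = y"
  by (simp add: rle_def bprod_eq_meet meet_eq_iff_join_eq)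

lemma rprod_bsum_right:
  assumes [simp]: "x \<in> carrier \<AA>" "y \<in> carrier \<AA>" "z \<in> carrier \<AA>"
  shows "x \<Zcomp> (y \<^bold>+ z) = x \<Zcomp> y \<^bold>+ x \<Zcomp> z"
proof -
  have "(x \<Zcomp> (y \<^bold>+ z))\<^sup>\<smile> = (x \<Zcomp> y \<^bold>+ x \<Zcomp> z)\<^sup>\<smile>"
    by (simp add: rconv_rprod rconv_bsum rprod_bsum)
  then show ?thesis
    by (metis assms bsum_closed rconv_rconv rprod_closed)
qed

lemma relation_algebra_modular:
  assumes [simp]: "x \<in> carrier \<AA>" "y \<in> carrier \<AA>" "z \<in> carrier \<AA>"
  shows "x \<Zcomp> y \<cdot> z \<preceq> x \<Zcomp> (y \<cdot> x\<^sup>\<smile> \<Zcomp> z)"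
proof -
  let ?w = "x\<^sup>\<smile> \<Zcomp> z"
  let ?p = "x \<Zcomp> (y \<cdot> ?w)" and ?q = "x \<Zcomp> (y \<cdot> \<sim>?w)"
  have "?q \<preceq> x \<Zcomp> \<sim>?w"
    using bprod_le_right[of y "\<sim>?w"] by (simp flip: rprod_bsum_right add: le_iff_bsum)
  moreover have "x \<Zcomp> \<sim>?w \<preceq> \<sim>z"
    using tarski[of "x\<^sup>\<smile>" z] by (simp add: rconv_rconv le_iff_bsum)
  ultimately have "?q \<preceq> \<sim>z"
    by (rule le_trans) auto
  then have absorbed: "?q \<^bold>+ \<sim>z = \<sim>z"
    by (simp add: le_iff_bsum)
  have "(?p \<^bold>+ ?q) \<^bold>+ (\<sim>z \<^bold>+ ?p) = (?q \<^bold>+ \<sim>z) \<^bold>+ ?p"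
    by (simp add: join_ac)
  then have "(?p \<^bold>+ ?q) \<^bold>+ (\<sim>z \<^bold>+ ?p) = \<sim>z \<^bold>+ ?p"
    by (simp only: absorbed)
  then have "(?p \<^bold>+ ?q) \<cdot> z \<preceq> ?p"
    by (simp add: le_iff_bsum bprod_eq_meet[of "?p \<^bold>+ ?q"] meet_join_eq_iff_join_compl)
  moreover have "?p \<^bold>+ ?q = x \<Zcomp> y"
    by (simp flip: rprod_bsum_right add: bprod_eq_meet meet_join_meet_compl)
  ultimately show ?thesis
    by simp
qed

theorem is_allegory: "allegory \<AA>"
proof
  fix x y z assume [simp]: "x \<in> carrier \<AA>" "y \<in> carrier \<AA>" "z \<in> carrier \<AA>"
  show "x \<cdot> \<^bold>1 = x"
    by (simp add: bprod_eq_meet meet_eq_iff_join_eq join_top)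
  show "(x \<cdot> y) \<Zcomp> z \<preceq> y \<Zcomp> z"
    using bprod_le_right[of x y] by (simp add: le_iff_bsum flip: rprod_bsum)
  show "(x \<cdot> y)\<^sup>\<smile> = x\<^sup>\<smile> \<cdot> y\<^sup>\<smile>"
  proof (rule mono_involution_bprod)
    show "u\<^sup>\<smile> \<preceq> v\<^sup>\<smile>" if "u \<preceq> v" and [simp]: "u \<in> carrier \<AA>" "v \<in> carrier \<AA>" for u v
      using that(1) by (simp add: le_iff_bsum flip: rconv_bsum)
  qed (simp_all add: rconv_rconv)
qed (rule bone_closed rprod_closed rconv_closed rid_closed rprod_assoc rprod_rid rconv_rconv
    rconv_rprod relation_algebra_modular; assumption)+

end

section \<open>Functional elements and mappings\<close>

context allegory
begin

lemma le_bone: "x \<in> carrier \<AA> \<Longrightarrow> x \<preceq> \<^bold>1"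
  by (simp add: rle_def bprod_bone)

lemma rconv_rid [simp]: "\<^bold>1'\<^sup>\<smile> = \<^bold>1'"
  using rconv_rprod[of "\<^bold>1'\<^sup>\<smile>" "\<^bold>1'"] by simp

lemma rid_rprod [simp]: "x \<in> carrier \<AA> \<Longrightarrow> \<^bold>1' \<Zcomp> x = x"
  using rconv_rprod[of "x\<^sup>\<smile>" "\<^bold>1'"] by simp

lemma rconv_inject: "\<lbrakk>x\<^sup>\<smile> = y\<^sup>\<smile>; x \<in> carrier \<AA>; y \<in> carrier \<AA>\<rbrakk> \<Longrightarrow> x = y"
  by (metis rconv_rconv)

lemma rconv_le: "\<lbrakk>x \<preceq> y; x \<in> carrier \<AA>; y \<in> carrier \<AA>\<rbrakk> \<Longrightarrow> x\<^sup>\<smile> \<preceq> y\<^sup>\<smile>"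
  by (metis rle_def rconv_bprod)

lemma rprod_le_left: "\<lbrakk>x \<preceq> y; x \<in> carrier \<AA>; y \<in> carrier \<AA>; z \<in> carrier \<AA>\<rbrakk> \<Longrightarrow> x \<Zcomp> z \<preceq> y \<Zcomp> z"
  by (metis bprod_rprod_le rle_def)

lemma rprod_le_right:
  assumes "x \<preceq> y" and [simp]: "x \<in> carrier \<AA>" "y \<in> carrier \<AA>" "z \<in> carrier \<AA>"
  shows "z \<Zcomp> x \<preceq> z \<Zcomp> y"
  using rconv_le[OF rprod_le_left[OF rconv_le[OF assms(1)]], of "z\<^sup>\<smile>"]
  by (simp add: rconv_rprod)

lemma rconv_bone: "\<^bold>1\<^sup>\<smile> = \<^bold>1"
  using rconv_le[OF le_bone, of "\<^bold>1\<^sup>\<smile>"] by (auto intro!: le_antisym le_bone)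

lemma rconv_rprod_self_mono:
  assumes "x \<preceq> y" and [simp]: "x \<in> carrier \<AA>" "y \<in> carrier \<AA>"
  shows "x\<^sup>\<smile> \<Zcomp> x \<preceq> y\<^sup>\<smile> \<Zcomp> y"
  by (rule le_trans[OF rprod_le_left[OF rconv_le[OF assms]] rprod_le_right[OF assms(1)]]) auto

lemma modular_left:
  assumes [simp]: "x \<in> carrier \<AA>" "y \<in> carrier \<AA>" "z \<in> carrier \<AA>"
  shows "x \<Zcomp> y \<cdot> z \<preceq> (x \<cdot> z \<Zcomp> y\<^sup>\<smile>) \<Zcomp> y"
  using rconv_le[OF modular[of "y\<^sup>\<smile>" "x\<^sup>\<smile>" "z\<^sup>\<smile>"]] by (simp add: rconv_rprod rconv_bprod)

lemma bprod_domain_rprod: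
  assumes [simp]: "x \<in> carrier \<AA>" "y \<in> carrier \<AA>" "z \<in> carrier \<AA>"
  shows "(x \<cdot> y \<Zcomp> \<^bold>1) \<Zcomp> z = x \<Zcomp> z \<cdot> y \<Zcomp> \<^bold>1"
proof (rule le_antisym)
  have domain: "y \<Zcomp> \<^bold>1 \<Zcomp> u \<preceq> y \<Zcomp> \<^bold>1" if [simp]: "u \<in> carrier \<AA>" for u
    using rprod_le_right[OF le_bone, of "\<^bold>1 \<Zcomp> u" y] by (simp add: rprod_assoc)
  have "(x \<cdot> y \<Zcomp> \<^bold>1) \<Zcomp> z \<preceq> y \<Zcomp> \<^bold>1"
    by (rule le_trans[OF bprod_rprod_le domain]) auto
  then show "(x \<cdot> y \<Zcomp> \<^bold>1) \<Zcomp> z \<preceq> x \<Zcomp> z \<cdot> y \<Zcomp> \<^bold>1"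
    by (intro le_bprodI rprod_le_left bprod_le_left) auto
  have "(x \<cdot> y \<Zcomp> \<^bold>1 \<Zcomp> z\<^sup>\<smile>) \<Zcomp> z \<preceq> (x \<cdot> y \<Zcomp> \<^bold>1) \<Zcomp> z"
    by (intro rprod_le_left bprod_le_mono domain le_refl) auto
  from le_trans[OF modular_left this] show "x \<Zcomp> z \<cdot> y \<Zcomp> \<^bold>1 \<preceq> (x \<cdot> y \<Zcomp> \<^bold>1) \<Zcomp> z"
    by simp
qed auto

lemma rprod_domain:
  assumes [simp]: "x \<in> carrier \<AA>" "y \<in> carrier \<AA>"
  shows "x \<Zcomp> y \<cdot> x \<Zcomp> \<^bold>1 = x \<Zcomp> y"
  using rprod_le_right[OF le_bone, of y x] by (simp add: rle_def)

lemma functional_carrier [simp]: "functional \<AA> f \<Longrightarrow> f \<in> carrier \<AA>"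
  unfolding functional_def by simp

lemma functional_le_rid: "functional \<AA> f \<Longrightarrow> f\<^sup>\<smile> \<Zcomp> f \<preceq> \<^bold>1'"
  unfolding functional_def by simp

lemma functionalI: "\<lbrakk>f\<^sup>\<smile> \<Zcomp> f \<preceq> \<^bold>1'; f \<in> carrier \<AA>\<rbrakk> \<Longrightarrow> functional \<AA> f"
  unfolding functional_def by simp

lemma functional_rid [simp]: "functional \<AA> \<^bold>1'"
  unfolding functional_def by (simp add: le_refl)

lemma functional_le:
  assumes f: "functional \<AA> f" and "g \<preceq> f" and [simp]: "g \<in> carrier \<AA>"
  shows "functional \<AA> g"
  using le_trans[OF rconv_rprod_self_mono[OF assms(2)] functional_le_rid[OF f]] f
  by (intro functionalI) simp_all

lemma rconv_rprod_functional_le: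
  assumes f: "functional \<AA> f" and [simp]: "x \<in> carrier \<AA>"
  shows "f\<^sup>\<smile> \<Zcomp> (f \<Zcomp> x) \<preceq> x"
  using rprod_le_left[OF functional_le_rid[OF f], of x] f by (simp add: rprod_assoc)

lemma functional_bprod:
  assumes f: "functional \<AA> f" and [simp]: "x \<in> carrier \<AA>" "y \<in> carrier \<AA>"
  shows "f \<Zcomp> (x \<cdot> y) = f \<Zcomp> x \<cdot> f \<Zcomp> y"
proof (rule le_antisym)
  note [simp] = functional_carrier[OF f]
  show "f \<Zcomp> (x \<cdot> y) \<preceq> f \<Zcomp> x \<cdot> f \<Zcomp> y"
    by (intro le_bprodI rprod_le_right bprod_le_left bprod_le_right) auto
  have "f \<Zcomp> (x \<cdot> f\<^sup>\<smile> \<Zcomp> (f \<Zcomp> y)) \<preceq> f \<Zcomp> (x \<cdot> y)"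
    by (intro rprod_le_right bprod_le_mono rconv_rprod_functional_le f le_refl) auto
  from le_trans[OF modular this] show "f \<Zcomp> x \<cdot> f \<Zcomp> y \<preceq> f \<Zcomp> (x \<cdot> y)"
    by simp
qed (use f in auto)

lemma bprod_rconv_functional:
  assumes f: "functional \<AA> f" and [simp]: "x \<in> carrier \<AA>" "y \<in> carrier \<AA>"
  shows "(x \<cdot> y) \<Zcomp> f\<^sup>\<smile> = x \<Zcomp> f\<^sup>\<smile> \<cdot> y \<Zcomp> f\<^sup>\<smile>"
proof (rule rconv_inject)
  show "((x \<cdot> y) \<Zcomp> f\<^sup>\<smile>)\<^sup>\<smile> = (x \<Zcomp> f\<^sup>\<smile> \<cdot> y \<Zcomp> f\<^sup>\<smile>)\<^sup>\<smile>"
    using f by (simp add: functional_bprod rconv_rprod rconv_bprod)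
qed (use f in auto)

lemma bprod_rprod_functional:
  assumes f: "functional \<AA> f" and [simp]: "x \<in> carrier \<AA>" "y \<in> carrier \<AA>"
  shows "(x \<cdot> y \<Zcomp> f\<^sup>\<smile>) \<Zcomp> f = x \<Zcomp> f \<cdot> y"
proof (rule le_antisym)
  note [simp] = functional_carrier[OF f]
  have "y \<Zcomp> f\<^sup>\<smile> \<Zcomp> f \<preceq> y"
    using rprod_le_right[OF functional_le_rid[OF f], of y] by (simp add: rprod_assoc)
  from le_trans[OF bprod_rprod_le this] have "(x \<cdot> y \<Zcomp> f\<^sup>\<smile>) \<Zcomp> f \<preceq> y"
    by simp
  then show "(x \<cdot> y \<Zcomp> f\<^sup>\<smile>) \<Zcomp> f \<preceq> x \<Zcomp> f \<cdot> y"
    by (intro le_bprodI rprod_le_left bprod_le_left) auto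
  show "x \<Zcomp> f \<cdot> y \<preceq> (x \<cdot> y \<Zcomp> f\<^sup>\<smile>) \<Zcomp> f"
    by (rule modular_left) auto
qed (use f in auto)

lemma functional_rprod [simp]:
  assumes f: "functional \<AA> f" and g: "functional \<AA> g"
  shows "functional \<AA> (f \<Zcomp> g)"
proof -
  note [simp] = functional_carrier[OF f] functional_carrier[OF g]
  have "g\<^sup>\<smile> \<Zcomp> (f\<^sup>\<smile> \<Zcomp> (f \<Zcomp> g)) \<preceq> g\<^sup>\<smile> \<Zcomp> g"
    by (intro rprod_le_right rconv_rprod_functional_le f) auto
  from le_trans[OF this functional_le_rid[OF g]] show ?thesis
    by (intro functionalI) (simp_all add: rconv_rprod rprod_assoc)
qed

lemma functional_rprod_rconv_le:
  assumes f: "functional \<AA> f" and [simp]: "x \<in> carrier \<AA>"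
  shows "(f \<Zcomp> x\<^sup>\<smile>)\<^sup>\<smile> \<Zcomp> (f \<Zcomp> x\<^sup>\<smile>) \<preceq> x \<Zcomp> x\<^sup>\<smile>"
  using rprod_le_right[OF rconv_rprod_functional_le[OF f, of "x\<^sup>\<smile>"], of x] f
  by (simp add: rconv_rprod rprod_assoc)

definition mapping :: "'a \<Rightarrow> bool"
  where "mapping f \<longleftrightarrow> functional \<AA> f \<and> f \<Zcomp> \<^bold>1 = \<^bold>1"

lemma mapping_functional [simp]: "mapping f \<Longrightarrow> functional \<AA> f"
  by (simp only: mapping_def)

lemma mapping_bone: "mapping f \<Longrightarrow> f \<Zcomp> \<^bold>1 = \<^bold>1"
  by (simp only: mapping_def)

lemma mapping_rid [simp]: "mapping \<^bold>1'"
  unfolding mapping_def by simp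

lemma mapping_rprod [simp]: "\<lbrakk>mapping f; mapping g\<rbrakk> \<Longrightarrow> mapping (f \<Zcomp> g)"
  unfolding mapping_def by (simp flip: rprod_assoc)

lemma permutational_carrier [simp]: "permutational \<AA> f \<Longrightarrow> f \<in> carrier \<AA>"
  unfolding permutational_def by simp

lemma permutational_rprod_rconv [simp]:
  "permutational \<AA> f \<Longrightarrow> f \<Zcomp> f\<^sup>\<smile> = \<^bold>1'"
  "permutational \<AA> f \<Longrightarrow> f\<^sup>\<smile> \<Zcomp> f = \<^bold>1'"
  unfolding permutational_def by simp_all

lemma permutationalI:
  "\<lbrakk>f \<Zcomp> f\<^sup>\<smile> = \<^bold>1'; f\<^sup>\<smile> \<Zcomp> f = \<^bold>1'; f \<in> carrier \<AA>\<rbrakk> \<Longrightarrow> permutational \<AA> f"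
  unfolding permutational_def by simp

lemma permutational_functional: "permutational \<AA> f \<Longrightarrow> functional \<AA> f"
  by (intro functionalI) (simp_all add: le_refl)

lemma permutational_rid [simp]: "permutational \<AA> \<^bold>1'"
  unfolding permutational_def by simp

lemma permutational_rconv [simp]: "permutational \<AA> f \<Longrightarrow> permutational \<AA> (f\<^sup>\<smile>)"
  unfolding permutational_def by simp

lemma permutational_rprod [simp]:
  assumes "permutational \<AA> f" "permutational \<AA> g"
  shows "permutational \<AA> (f \<Zcomp> g)"
proof -
  note [simp] = permutational_carrier[OF assms(1)] permutational_carrier[OF assms(2)]
  have "(f \<Zcomp> g) \<Zcomp> (g\<^sup>\<smile> \<Zcomp> f\<^sup>\<smile>) = f \<Zcomp> (g \<Zcomp> g\<^sup>\<smile>) \<Zcomp> f\<^sup>\<smile>"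
    and "(g\<^sup>\<smile> \<Zcomp> f\<^sup>\<smile>) \<Zcomp> (f \<Zcomp> g) = g\<^sup>\<smile> \<Zcomp> (f\<^sup>\<smile> \<Zcomp> f) \<Zcomp> g"
    by (simp_all add: rprod_assoc)
  then show ?thesis
    using assms by (intro permutationalI) (simp_all add: rconv_rprod)
qed

lemma commutator_eq_rid:
  assumes "permutational \<AA> f" "permutational \<AA> g" "f \<Zcomp> g = g \<Zcomp> f"
  shows "f \<Zcomp> g \<Zcomp> f\<^sup>\<smile> \<Zcomp> g\<^sup>\<smile> = \<^bold>1'"
proof -
  have "f \<Zcomp> g \<Zcomp> f\<^sup>\<smile> \<Zcomp> g\<^sup>\<smile> = g \<Zcomp> (f \<Zcomp> f\<^sup>\<smile>) \<Zcomp> g\<^sup>\<smile>"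
    using assms by (simp add: rprod_assoc del: permutational_rprod_rconv)
  then show ?thesis
    using assms by simp
qed

lemma Fn_simps [simp]:
  "carrier (Fn \<AA>) = {f. functional \<AA> f}" "f \<otimes>\<^bsub>Fn \<AA>\<^esub> g = f \<Zcomp> g" "\<one>\<^bsub>Fn \<AA>\<^esub> = \<^bold>1'"
  by (simp_all add: Fn_def)

lemma Pm_simps [simp]:
  "carrier (Pm \<AA>) = {f. permutational \<AA> f}" "f \<otimes>\<^bsub>Pm \<AA>\<^esub> g = f \<Zcomp> g" "\<one>\<^bsub>Pm \<AA>\<^esub> = \<^bold>1'"
  by (simp_all add: Pm_def)

lemma monoid_Fn: "Group.monoid (Fn \<AA>)"
  by (rule monoidI) (auto simp: rprod_assoc)

lemma group_Pm: "group (Pm \<AA>)"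
proof (rule groupI)
  fix f assume "f \<in> carrier (Pm \<AA>)"
  then show "\<exists>g\<in>carrier (Pm \<AA>). g \<otimes>\<^bsub>Pm \<AA>\<^esub> f = \<one>\<^bsub>Pm \<AA>\<^esub>"
    by (intro bexI[of _ "f\<^sup>\<smile>"]) auto
qed (auto simp: rprod_assoc)

lemma inv_Pm: "permutational \<AA> f \<Longrightarrow> inv\<^bsub>Pm \<AA>\<^esub> f = f\<^sup>\<smile>"
  by (rule group.inv_equality[OF group_Pm]) auto

end

section \<open>Images of presented monoids and groups\<close>

primrec word_eval :: "('c, 'd) monoid_scheme \<Rightarrow> ('l \<Rightarrow> 'c) \<Rightarrow> 'l list \<Rightarrow> 'c" where
  "word_eval G f [] = \<one>\<^bsub>G\<^esub>"
| "word_eval G f (l # w) = f l \<otimes>\<^bsub>G\<^esub> word_eval G f w"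

definition word_class :: "'l set \<Rightarrow> ('l list \<times> 'l list) set \<Rightarrow> 'l list \<Rightarrow> 'l list set"
  where "word_class S R u = {w. pcong S R u w}"

lemma word_class_self: "u \<in> lists S \<Longrightarrow> u \<in> word_class S R u"
  by (simp add: word_class_def pcong.cong_refl)

lemma word_class_append_cong:
  "\<lbrakk>u' \<in> word_class S R u; v' \<in> word_class S R v\<rbrakk> \<Longrightarrow>
    word_class S R (u' @ v') = word_class S R (u @ v)"
  unfolding word_class_def by (auto intro: pcong.cong_app pcong.cong_sym pcong.cong_trans)

lemma carrier_presented_monoid: "carrier (presented_monoid S R) = word_class S R ` lists S"
  by (auto simp: presented_monoid_def quotient_def word_class_def)

lemma one_presented_monoid: "\<one>\<^bsub>presented_monoid S R\<^esub> = word_class S R []"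
  by (simp add: presented_monoid_def word_class_def)

lemma mult_presented_monoid:
  assumes "u \<in> lists S" "v \<in> lists S"
  shows "word_class S R u \<otimes>\<^bsub>presented_monoid S R\<^esub> word_class S R v = word_class S R (u @ v)"
proof -
  have "word_class S R u \<otimes>\<^bsub>presented_monoid S R\<^esub> word_class S R v =
      (\<Union>u'\<in>word_class S R u. \<Union>v'\<in>word_class S R v. word_class S R (u' @ v'))"
    by (simp add: presented_monoid_def word_class_def)
  also have "\<dots> = (\<Union>u'\<in>word_class S R u. \<Union>v'\<in>word_class S R v. word_class S R (u @ v))"
    by (intro SUP_cong refl word_class_append_cong)
  also have "\<dots> = word_class S R (u @ v)"
    using word_class_self[OF assms(1)] word_class_self[OF assms(2)] by auto
  finally show ?thesis .
qed

lemma submonoid_generated_carrier: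
  "submonoid_generated G S = G\<lparr>carrier := carrier (submonoid_generated G S)\<rparr>"
  by (simp add: submonoid_generated_def)

context Group.monoid
begin

lemma submonoid_submonoid_generated: "submonoid (carrier (submonoid_generated G S)) G"
  unfolding submonoid_generated_def
  by unfold_locales (auto dest: submonoid.subset submonoid.m_closed submonoid.one_closed
      intro: submonoid.intro)

lemma submonoid_generated_m_closed:
  "\<lbrakk>x \<in> carrier (submonoid_generated G S); y \<in> carrier (submonoid_generated G S)\<rbrakk> \<Longrightarrow>
    x \<otimes> y \<in> carrier (submonoid_generated G S)"
  by (rule submonoid.m_closed[OF submonoid_submonoid_generated])

lemma submonoid_generated_incl:
  "\<lbrakk>x \<in> S; x \<in> carrier G\<rbrakk> \<Longrightarrow> x \<in> carrier (submonoid_generated G S)"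
  unfolding submonoid_generated_def by auto

lemma submonoid_generated_minimal:
  "\<lbrakk>submonoid H G; S \<subseteq> H\<rbrakk> \<Longrightarrow> carrier (submonoid_generated G S) \<subseteq> H"
  unfolding submonoid_generated_def by auto

lemma submonoid_generated_eqI:
  assumes "S \<subseteq> carrier (submonoid_generated G T)" "T \<subseteq> carrier (submonoid_generated G S)"
  shows "submonoid_generated G S = submonoid_generated G T"
proof -
  have "carrier (submonoid_generated G S) = carrier (submonoid_generated G T)"
    by (intro equalityI submonoid_generated_minimal submonoid_submonoid_generated assms)
  then show ?thesis
    by (metis submonoid_generated_carrier)
qed

lemma word_eval_closed:
  assumes "f \<in> S \<rightarrow> carrier G" "w \<in> lists S"
  shows "word_eval G f w \<in> carrier G"
  using assms(2) by induction (use assms(1) in auto)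

lemma word_eval_append:
  assumes f: "f \<in> S \<rightarrow> carrier G" and "u \<in> lists S" and v: "v \<in> lists S"
  shows "word_eval G f (u @ v) = word_eval G f u \<otimes> word_eval G f v"
  using assms(2)
proof induction
  case (Cons l w)
  then have "f l \<in> carrier G"
    using f by auto
  with Cons show ?case
    by (simp add: m_assoc word_eval_closed[OF f] v)
qed (simp add: word_eval_closed[OF f] v)

lemma submonoid_word_eval_image_lists:
  assumes f: "f \<in> S \<rightarrow> carrier G"
  shows "submonoid (word_eval G f ` lists S) G"
proof
  show "word_eval G f ` lists S \<subseteq> carrier G"
    using word_eval_closed[OF f] by auto
  show "\<one> \<in> word_eval G f ` lists S"
    by (rule image_eqI[of _ _ "[]"]) auto
  fix x y assume "x \<in> word_eval G f ` lists S" "y \<in> word_eval G f ` lists S"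
  then obtain u v where "u \<in> lists S" "v \<in> lists S" "x = word_eval G f u" "y = word_eval G f v"
    by blast
  then show "x \<otimes> y \<in> word_eval G f ` lists S"
    by (intro image_eqI[of _ _ "u @ v"]) (simp_all add: word_eval_append[OF f])
qed

lemma word_eval_image_lists:
  assumes f: "f \<in> S \<rightarrow> carrier G"
  shows "word_eval G f ` lists S = carrier (submonoid_generated G (f ` S))" (is "?W = ?H")
proof
  show "?W \<subseteq> ?H"
  proof (rule image_subsetI)
    fix w assume "w \<in> lists S"
    then show "word_eval G f w \<in> ?H"
    proof induction
      case Nil
      show ?case
        using submonoid.one_closed[OF submonoid_submonoid_generated] by simp
    next
      case (Cons l w)
      then have "f l \<in> ?H"
        using f by (intro submonoid_generated_incl) (simp_all add: Pi_iff)
      with Cons.IH show ?case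
        by (simp add: submonoid_generated_m_closed)
    qed
  qed
  show "?H \<subseteq> ?W"
  proof (rule submonoid_generated_minimal)
    show "submonoid ?W G"
      by (rule submonoid_word_eval_image_lists[OF f])
    show "f ` S \<subseteq> ?W"
    proof (rule image_subsetI)
      fix l assume "l \<in> S"
      then show "f l \<in> ?W"
        using f by (intro image_eqI[of _ _ "[l]"]) (simp_all add: Pi_iff)
    qed
  qed
qed

lemma word_eval_pcong:
  assumes f: "f \<in> S \<rightarrow> carrier G" and R: "R \<subseteq> lists S \<times> lists S"
    and eval_R: "\<And>u v. (u, v) \<in> R \<Longrightarrow> word_eval G f u = word_eval G f v"
    and "pcong S R u v"
  shows "u \<in> lists S \<and> v \<in> lists S \<and> word_eval G f u = word_eval G f v"
  using assms(4)
proof induction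
  case (cong_app u u' v v')
  then show ?case
    by (auto simp: word_eval_append[OF f])
qed (use R eval_R in auto)

theorem monoid_image_presented_monoid:
  assumes f: "f \<in> S \<rightarrow> carrier G" and R: "R \<subseteq> lists S \<times> lists S"
    and eval_R: "\<And>u v. (u, v) \<in> R \<Longrightarrow> word_eval G f u = word_eval G f v"
  shows "monoid_image (submonoid_generated G (f ` S)) (presented_monoid S R)"
proof -
  let ?M = "presented_monoid S R" and ?H = "submonoid_generated G (f ` S)"
  define h where "h X = the_elem (word_eval G f ` X)" for X
  have h: "h (word_class S R u) = word_eval G f u" if "u \<in> lists S" for u
  proof -
    have "word_eval G f ` word_class S R u = {word_eval G f u}"
      using word_class_self[OF that] word_eval_pcong[OF f R eval_R]
      by (force simp: word_class_def)
    then show ?thesis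
      by (simp add: h_def)
  qed
  have H: "carrier ?H = word_eval G f ` lists S" "mult ?H = mult G" "\<one>\<^bsub>?H\<^esub> = \<one>"
    by (simp_all only: word_eval_image_lists[OF f]) (simp_all add: submonoid_generated_def)
  have h_image: "h ` carrier ?M = carrier ?H"
    unfolding carrier_presented_monoid image_image H by (rule image_cong[OF refl h])
  have "h \<in> hom ?M ?H"
  proof (rule homI)
    fix X Y assume "X \<in> carrier ?M" "Y \<in> carrier ?M"
    then obtain u v where "u \<in> lists S" "v \<in> lists S"
      and "X = word_class S R u" "Y = word_class S R v"
      unfolding carrier_presented_monoid by blast
    then show "h (X \<otimes>\<^bsub>?M\<^esub> Y) = h X \<otimes>\<^bsub>?H\<^esub> h Y"
      by (simp add: mult_presented_monoid h H word_eval_append[OF f])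
  qed (use h_image in auto)
  moreover have "h \<one>\<^bsub>?M\<^esub> = \<one>\<^bsub>?H\<^esub>"
    by (simp add: one_presented_monoid h H)
  ultimately show ?thesis
    unfolding monoid_image_def epi_def using h_image by blast
qed

end

context group
begin

lemma subgroup_generated_eq_submonoid_generated:
  assumes K: "K \<subseteq> carrier G"
  shows "subgroup_generated G K = submonoid_generated G (K \<union> m_inv G ` K)"
proof -
  let ?H = "carrier (submonoid_generated G (K \<union> m_inv G ` K))"
  have incl: "x \<in> ?H" if "x \<in> K \<union> m_inv G ` K" for x
    using that K by (intro submonoid_generated_incl) auto
  have "generate G K \<subseteq> ?H"
  proof
    fix x assume "x \<in> generate G K"
    then show "x \<in> ?H"
      using submonoid.one_closed[OF submonoid_submonoid_generated]
      by induction (auto intro: incl submonoid_generated_m_closed)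
  qed
  moreover have "?H \<subseteq> generate G K"
    using generate_is_subgroup[OF K]
    by (intro submonoid_generated_minimal subgroup.subgroup_is_submonoid)
      (auto intro: generate.incl generate.inv)
  ultimately have "generate G K = ?H"
    by blast
  then show ?thesis
    using K by (metis inf.absorb2 submonoid_generated_carrier subgroup_generated_def)
qed

lemma word_eval_winv:
  assumes f: "f \<in> S \<times> UNIV \<rightarrow> carrier G" and inv: "\<And>g e. g \<in> S \<Longrightarrow> f (g, \<not> e) = inv f (g, e)"
    and "w \<in> lists (S \<times> UNIV)"
  shows "word_eval G f (winv w) = inv word_eval G f w"
  using assms(3)
proof induction
  case (Cons l w)
  obtain g e where l: "l = (g, e)" "g \<in> S"
    using Cons.hyps(1) by auto
  have closed: "f (g, e) \<in> carrier G" "word_eval G f w \<in> carrier G"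
    using f l Cons.hyps(2) by (auto intro: word_eval_closed)
  have "winv w \<in> lists (S \<times> UNIV)"
    using Cons.hyps(2) by (auto simp: winv_def)
  moreover have "winv (l # w) = winv w @ [(g, \<not> e)]"
    by (simp add: winv_def l)
  ultimately show ?case
    using l closed Cons.IH by (simp add: word_eval_append[OF f] inv inv_mult_group)
qed (simp add: winv_def)

theorem group_image_presented_group:
  assumes f: "f \<in> S \<times> UNIV \<rightarrow> carrier G" and inv: "\<And>g e. g \<in> S \<Longrightarrow> f (g, \<not> e) = inv f (g, e)"
    and R: "R \<subseteq> lists (S \<times> UNIV) \<times> lists (S \<times> UNIV)"
    and eval_R: "\<And>u v. (u, v) \<in> R \<Longrightarrow> word_eval G f u = word_eval G f v"
  shows "group_image (subgroup_generated G ((\<lambda>g. f (g, e)) ` S)) (presented_group S R)"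
proof -
  let ?R = "R \<union> {([(g, e), (g, \<not> e)], []) | g e. g \<in> S}"
  let ?K = "(\<lambda>g. f (g, e)) ` S"
  have "word_eval G f [(g, e), (g, \<not> e)] = \<one>" if "g \<in> S" for g e
    using f that by (auto simp: inv Pi_iff)
  then have "monoid_image (submonoid_generated G (f ` (S \<times> UNIV))) (presented_group S R)"
    unfolding presented_group_def using R eval_R
    by (intro monoid_image_presented_monoid f) auto
  moreover have "f ` (S \<times> UNIV) = ?K \<union> m_inv G ` ?K"
  proof -
    have "f ` (S \<times> UNIV) = ?K \<union> (\<lambda>g. f (g, \<not> e)) ` S"
      by (cases e) (auto simp: UNIV_bool)
    also have "(\<lambda>g. f (g, \<not> e)) ` S = m_inv G ` ?K"
      using inv by (auto simp: image_iff)
    finally show ?thesis .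
  qed
  moreover have "?K \<subseteq> carrier G"
    using f by auto
  ultimately show ?thesis
    unfolding monoid_image_def group_image_def
    by (auto simp: subgroup_generated_eq_submonoid_generated)
qed

end

section \<open>Pairing\<close>

locale projection_pair = allegory +
  fixes a b :: 'a
  assumes a_closed [simp, intro]: "a \<in> carrier \<AA>"
    and b_closed [simp, intro]: "b \<in> carrier \<AA>"
    and rconv_a_a: "a\<^sup>\<smile> \<Zcomp> a = \<^bold>1'"
    and rconv_b_b: "b\<^sup>\<smile> \<Zcomp> b = \<^bold>1'"
    and projections_separate: "a \<Zcomp> a\<^sup>\<smile> \<cdot> b \<Zcomp> b\<^sup>\<smile> = \<^bold>1'"
    and rconv_a_b: "a\<^sup>\<smile> \<Zcomp> b = \<^bold>1"
    and a_total: "a \<Zcomp> \<^bold>1 = \<^bold>1"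
    and b_total: "b \<Zcomp> \<^bold>1 = \<^bold>1"
begin

definition fork :: "'a \<Rightarrow> 'a \<Rightarrow> 'a"
  where "fork x y = x \<Zcomp> a\<^sup>\<smile> \<cdot> y \<Zcomp> b\<^sup>\<smile>"

definition defer\<^sub>0 :: "'a \<Rightarrow> 'a"
  where "defer\<^sub>0 x = a \<Zcomp> x \<Zcomp> a\<^sup>\<smile> \<cdot> b \<Zcomp> b\<^sup>\<smile>"

definition defer\<^sub>1 :: "'a \<Rightarrow> 'a"
  where "defer\<^sub>1 x = a \<Zcomp> a\<^sup>\<smile> \<cdot> b \<Zcomp> x \<Zcomp> b\<^sup>\<smile>"

lemma mapping_a [simp]: "mapping a" and mapping_b [simp]: "mapping b"
  unfolding mapping_def functional_def
  by (simp_all add: rconv_a_a rconv_b_b a_total b_total le_refl)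

lemma rconv_b_a: "b\<^sup>\<smile> \<Zcomp> a = \<^bold>1"
  using rconv_rprod[of "a\<^sup>\<smile>" b] by (simp add: rconv_a_b rconv_bone)

lemma fork_closed [simp, intro]: "\<lbrakk>x \<in> carrier \<AA>; y \<in> carrier \<AA>\<rbrakk> \<Longrightarrow> fork x y \<in> carrier \<AA>"
  by (simp add: fork_def)

lemma fork_fork_left:
  "\<lbrakk>x \<in> carrier \<AA>; y \<in> carrier \<AA>; z \<in> carrier \<AA>\<rbrakk> \<Longrightarrow>
    fork (fork x y) z = x \<Zcomp> a\<^sup>\<smile> \<Zcomp> a\<^sup>\<smile> \<cdot> y \<Zcomp> b\<^sup>\<smile> \<Zcomp> a\<^sup>\<smile> \<cdot> z \<Zcomp> b\<^sup>\<smile>"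
  by (simp add: fork_def bprod_rconv_functional)

lemma fork_fork_right:
  "\<lbrakk>x \<in> carrier \<AA>; y \<in> carrier \<AA>; z \<in> carrier \<AA>\<rbrakk> \<Longrightarrow>
    fork x (fork y z) = x \<Zcomp> a\<^sup>\<smile> \<cdot> (y \<Zcomp> a\<^sup>\<smile> \<Zcomp> b\<^sup>\<smile> \<cdot> z \<Zcomp> b\<^sup>\<smile> \<Zcomp> b\<^sup>\<smile>)"
  by (simp add: fork_def bprod_rconv_functional)

lemma functional_fork [simp]:
  assumes x: "functional \<AA> x" and y: "functional \<AA> y"
  shows "functional \<AA> (fork x y)"
proof -
  note [simp] = functional_carrier[OF x] functional_carrier[OF y]
  have "(fork x y)\<^sup>\<smile> \<Zcomp> fork x y \<preceq> a \<Zcomp> a\<^sup>\<smile> \<cdot> b \<Zcomp> b\<^sup>\<smile>"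
    unfolding fork_def
  proof (rule le_bprodI)
    let ?f = "x \<Zcomp> a\<^sup>\<smile> \<cdot> y \<Zcomp> b\<^sup>\<smile>"
    show "?f\<^sup>\<smile> \<Zcomp> ?f \<preceq> a \<Zcomp> a\<^sup>\<smile>"
      by (rule le_trans[OF rconv_rprod_self_mono[OF bprod_le_left]
            functional_rprod_rconv_le[OF x]]) auto
    show "?f\<^sup>\<smile> \<Zcomp> ?f \<preceq> b \<Zcomp> b\<^sup>\<smile>"
      by (rule le_trans[OF rconv_rprod_self_mono[OF bprod_le_right]
            functional_rprod_rconv_le[OF y]]) auto
  qed auto
  then show ?thesis
    by (intro functionalI) (simp_all add: projections_separate)
qed

lemma fork_rprod_a_domain:
  assumes [simp]: "x \<in> carrier \<AA>" "y \<in> carrier \<AA>"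
  shows "fork x y \<Zcomp> a = x \<cdot> y \<Zcomp> \<^bold>1"
proof -
  have "fork x y \<Zcomp> a = (y \<Zcomp> b\<^sup>\<smile> \<cdot> x \<Zcomp> a\<^sup>\<smile>) \<Zcomp> a"
    by (simp add: fork_def bprod_comm)
  also have "\<dots> = y \<Zcomp> (b\<^sup>\<smile> \<Zcomp> a) \<cdot> x"
    by (simp add: bprod_rprod_functional rprod_assoc)
  finally show ?thesis
    by (simp add: rconv_b_a bprod_comm)
qed

lemma fork_rprod_b_domain:
  assumes [simp]: "x \<in> carrier \<AA>" "y \<in> carrier \<AA>"
  shows "fork x y \<Zcomp> b = y \<cdot> x \<Zcomp> \<^bold>1"
proof -
  have "fork x y \<Zcomp> b = x \<Zcomp> (a\<^sup>\<smile> \<Zcomp> b) \<cdot> y"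
    by (simp add: fork_def bprod_rprod_functional rprod_assoc)
  then show ?thesis
    by (simp add: rconv_a_b bprod_comm)
qed

lemma fork_rprod_a [simp]: "\<lbrakk>x \<in> carrier \<AA>; mapping y\<rbrakk> \<Longrightarrow> fork x y \<Zcomp> a = x"
  by (simp add: fork_rprod_a_domain mapping_bone bprod_bone)

lemma fork_rprod_b [simp]: "\<lbrakk>mapping x; y \<in> carrier \<AA>\<rbrakk> \<Longrightarrow> fork x y \<Zcomp> b = y"
  by (simp add: fork_rprod_b_domain mapping_bone bprod_bone)

lemma rprod_fork [simp]:
  "\<lbrakk>functional \<AA> f; x \<in> carrier \<AA>; y \<in> carrier \<AA>\<rbrakk> \<Longrightarrow> f \<Zcomp> fork x y = fork (f \<Zcomp> x) (f \<Zcomp> y)"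
  by (simp add: fork_def functional_bprod rprod_assoc)

lemma fork_a_b [simp]: "fork a b = \<^bold>1'"
  by (simp add: fork_def projections_separate)

lemma fork_surjective [simp]: "functional \<AA> f \<Longrightarrow> fork (f \<Zcomp> a) (f \<Zcomp> b) = f"
  using rprod_fork[of f a b] by simp

lemma mapping_fork [simp]:
  assumes "mapping x" "mapping y"
  shows "mapping (fork x y)"
proof -
  have "fork x y \<Zcomp> \<^bold>1 = fork x y \<Zcomp> (a \<Zcomp> \<^bold>1)"
    by (simp only: a_total)
  also have "\<dots> = \<^bold>1"
    using assms by (subst rprod_assoc) (simp_all add: mapping_bone)
  finally show ?thesis
    using assms unfolding mapping_def by simp
qed

lemma fork_rprod_fork:
  assumes x: "functional \<AA> x" and y: "functional \<AA> y"
    and [simp]: "u \<in> carrier \<AA>" "v \<in> carrier \<AA>"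
  shows "fork x y \<Zcomp> fork (a \<Zcomp> u) (b \<Zcomp> v) = fork (x \<Zcomp> u) (y \<Zcomp> v)"
proof -
  note [simp] = functional_carrier[OF x] functional_carrier[OF y]
  have "fork x y \<Zcomp> fork (a \<Zcomp> u) (b \<Zcomp> v) = fork ((x \<cdot> y \<Zcomp> \<^bold>1) \<Zcomp> u) ((y \<cdot> x \<Zcomp> \<^bold>1) \<Zcomp> v)"
    using x y by (simp add: rprod_assoc fork_rprod_a_domain fork_rprod_b_domain)
  also have "\<dots> = (x \<Zcomp> (u \<Zcomp> a\<^sup>\<smile>) \<cdot> y \<Zcomp> \<^bold>1) \<cdot> (y \<Zcomp> (v \<Zcomp> b\<^sup>\<smile>) \<cdot> x \<Zcomp> \<^bold>1)"
    by (simp add: fork_def bprod_domain_rprod flip: rprod_assoc)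
  also have "\<dots> = (x \<Zcomp> (u \<Zcomp> a\<^sup>\<smile>) \<cdot> x \<Zcomp> \<^bold>1) \<cdot> (y \<Zcomp> (v \<Zcomp> b\<^sup>\<smile>) \<cdot> y \<Zcomp> \<^bold>1)"
    by (simp add: bprod_ac)
  also have "\<dots> = fork (x \<Zcomp> u) (y \<Zcomp> v)"
    by (simp add: rprod_domain fork_def flip: rprod_assoc)
  finally show ?thesis .
qed

lemma defer\<^sub>0_eq_fork: "defer\<^sub>0 x = fork (a \<Zcomp> x) b"
  and defer\<^sub>1_eq_fork: "x \<in> carrier \<AA> \<Longrightarrow> defer\<^sub>1 x = fork a (b \<Zcomp> x)"
  by (simp_all add: defer\<^sub>0_def defer\<^sub>1_def fork_def)

lemma functional_defer [simp]:
  "functional \<AA> x \<Longrightarrow> functional \<AA> (defer\<^sub>0 x)"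
  "functional \<AA> x \<Longrightarrow> functional \<AA> (defer\<^sub>1 x)"
  by (simp_all add: defer\<^sub>0_eq_fork defer\<^sub>1_eq_fork)

lemma mapping_defer [simp]:
  "mapping x \<Longrightarrow> mapping (defer\<^sub>0 x)"
  "mapping x \<Longrightarrow> mapping (defer\<^sub>1 x)"
  by (simp_all add: defer\<^sub>0_eq_fork defer\<^sub>1_eq_fork)

lemma fork_rprod_defer:
  assumes "functional \<AA> x" "functional \<AA> y" "functional \<AA> u"
  shows fork_rprod_defer\<^sub>0: "fork x y \<Zcomp> defer\<^sub>0 u = fork (x \<Zcomp> u) y"
    and fork_rprod_defer\<^sub>1: "fork x y \<Zcomp> defer\<^sub>1 u = fork x (y \<Zcomp> u)"
  using assms fork_rprod_fork[of x y u "\<^bold>1'"] fork_rprod_fork[of x y "\<^bold>1'" u]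
  by (simp_all add: defer\<^sub>0_eq_fork defer\<^sub>1_eq_fork del: rprod_fork)

lemma defer_rid [simp]: "defer\<^sub>0 \<^bold>1' = \<^bold>1'" "defer\<^sub>1 \<^bold>1' = \<^bold>1'"
  by (simp_all add: defer\<^sub>0_eq_fork defer\<^sub>1_eq_fork)

lemma defer_rprod:
  assumes "functional \<AA> x" "functional \<AA> y"
  shows "defer\<^sub>0 (x \<Zcomp> y) = defer\<^sub>0 x \<Zcomp> defer\<^sub>0 y" "defer\<^sub>1 (x \<Zcomp> y) = defer\<^sub>1 x \<Zcomp> defer\<^sub>1 y"
proof -
  have "defer\<^sub>0 x \<Zcomp> defer\<^sub>0 y = fork (a \<Zcomp> x \<Zcomp> y) b" "defer\<^sub>1 x \<Zcomp> defer\<^sub>1 y = fork a (b \<Zcomp> x \<Zcomp> y)"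
    using assms fork_rprod_defer\<^sub>0[of "a \<Zcomp> x" b y] fork_rprod_defer\<^sub>1[of a "b \<Zcomp> x" y]
    by (simp_all flip: defer\<^sub>0_eq_fork defer\<^sub>1_eq_fork)
  then show "defer\<^sub>0 (x \<Zcomp> y) = defer\<^sub>0 x \<Zcomp> defer\<^sub>0 y" "defer\<^sub>1 (x \<Zcomp> y) = defer\<^sub>1 x \<Zcomp> defer\<^sub>1 y"
    using assms by (simp_all add: defer\<^sub>0_eq_fork defer\<^sub>1_eq_fork rprod_assoc del: rprod_fork)
qed

lemma defer_commute:
  assumes "functional \<AA> x" "functional \<AA> y"
  shows "defer\<^sub>0 x \<Zcomp> defer\<^sub>1 y = defer\<^sub>1 y \<Zcomp> defer\<^sub>0 x"
proof -
  have "defer\<^sub>0 x \<Zcomp> defer\<^sub>1 y = fork (a \<Zcomp> x) (b \<Zcomp> y)" "defer\<^sub>1 y \<Zcomp> defer\<^sub>0 x = fork (a \<Zcomp> x) (b \<Zcomp> y)"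
    using assms fork_rprod_defer\<^sub>1[of "a \<Zcomp> x" b y] fork_rprod_defer\<^sub>0[of a "b \<Zcomp> y" x]
    by (simp_all flip: defer\<^sub>0_eq_fork defer\<^sub>1_eq_fork)
  then show ?thesis
    by simp
qed

lemma rconv_defer:
  assumes "x \<in> carrier \<AA>"
  shows "(defer\<^sub>0 x)\<^sup>\<smile> = defer\<^sub>0 (x\<^sup>\<smile>)" "(defer\<^sub>1 x)\<^sup>\<smile> = defer\<^sub>1 (x\<^sup>\<smile>)"
  using assms by (simp_all add: defer\<^sub>0_def defer\<^sub>1_def rconv_bprod rconv_rprod rprod_assoc)

lemma permutational_defer [simp]:
  assumes x: "permutational \<AA> x"
  shows "permutational \<AA> (defer\<^sub>0 x)" "permutational \<AA> (defer\<^sub>1 x)"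
proof -
  have "functional \<AA> x" "functional \<AA> (x\<^sup>\<smile>)"
    using x by (simp_all add: permutational_functional)
  then show "permutational \<AA> (defer\<^sub>0 x)" "permutational \<AA> (defer\<^sub>1 x)"
    using x by (auto intro!: permutationalI simp: rconv_defer simp flip: defer_rprod)
qed

end

section \<open>The elements of Thompson's groups\<close>

context projection_pair
begin

definition U :: 'a where "U = a\<^sup>\<smile> \<cdot> b\<^sup>\<smile>"
definition P :: 'a where "P = a \<Zcomp> b\<^sup>\<smile> \<cdot> b \<Zcomp> a\<^sup>\<smile>"
definition R :: 'a
  where "R = a \<Zcomp> (a\<^sup>\<smile> \<Zcomp> a\<^sup>\<smile>) \<cdot> b \<Zcomp> a \<Zcomp> b\<^sup>\<smile> \<Zcomp> a\<^sup>\<smile> \<cdot> (b \<Zcomp> b) \<Zcomp> b\<^sup>\<smile>"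
definition B :: 'a where "B = defer\<^sub>1 R"
definition C :: 'a
  where "C = a \<Zcomp> (b\<^sup>\<smile> \<Zcomp> b\<^sup>\<smile>) \<cdot> b \<Zcomp> a \<Zcomp> a\<^sup>\<smile> \<cdot> (b \<Zcomp> b) \<Zcomp> a\<^sup>\<smile> \<Zcomp> b\<^sup>\<smile>"
definition \<pi>\<^sub>0 :: 'a
  where "\<pi>\<^sub>0 = a \<Zcomp> a\<^sup>\<smile> \<Zcomp> b\<^sup>\<smile> \<cdot> b \<Zcomp> a \<Zcomp> a\<^sup>\<smile> \<cdot> (b \<Zcomp> b) \<Zcomp> (b\<^sup>\<smile> \<Zcomp> b\<^sup>\<smile>)"
definition X\<^sub>2 :: 'a where "X\<^sub>2 = R \<Zcomp> B \<Zcomp> R\<^sup>\<smile>"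
definition X\<^sub>3 :: 'a where "X\<^sub>3 = (R \<Zcomp> R) \<Zcomp> B \<Zcomp> (R\<^sup>\<smile> \<Zcomp> R\<^sup>\<smile>)"
definition C\<^sub>2 :: 'a where "C\<^sub>2 = B \<Zcomp> C \<Zcomp> R\<^sup>\<smile>"
definition C\<^sub>3 :: 'a where "C\<^sub>3 = (B \<Zcomp> B) \<Zcomp> C \<Zcomp> (R\<^sup>\<smile> \<Zcomp> R\<^sup>\<smile>)"
definition \<pi>\<^sub>1 :: 'a where "\<pi>\<^sub>1 = C\<^sub>2 \<Zcomp> \<pi>\<^sub>0 \<Zcomp> C\<^sub>2\<^sup>\<smile>"
definition \<pi>\<^sub>2 :: 'a where "\<pi>\<^sub>2 = R \<Zcomp> \<pi>\<^sub>1 \<Zcomp> R\<^sup>\<smile>"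
definition \<pi>\<^sub>3 :: 'a where "\<pi>\<^sub>3 = (R \<Zcomp> R) \<Zcomp> \<pi>\<^sub>1 \<Zcomp> (R\<^sup>\<smile> \<Zcomp> R\<^sup>\<smile>)"

lemmas element_defs = U_def P_def R_def B_def C_def \<pi>\<^sub>0_def X\<^sub>2_def X\<^sub>3_def C\<^sub>2_def C\<^sub>3_def
  \<pi>\<^sub>1_def \<pi>\<^sub>2_def \<pi>\<^sub>3_def defer\<^sub>0_def defer\<^sub>1_def

lemma U_eq_fork: "U = fork \<^bold>1' \<^bold>1'"
  by (simp add: U_def fork_def)

lemma P_eq_fork: "P = fork b a"
  by (simp add: P_def fork_def bprod_comm)

lemma R_eq_fork: "R = fork (fork a (b \<Zcomp> a)) (b \<Zcomp> b)"
  by (simp add: R_def fork_fork_left rprod_assoc)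

lemma C_eq_fork: "C = fork (b \<Zcomp> a) (fork (b \<Zcomp> b) a)"
  by (simp add: C_def fork_fork_right bprod_ac flip: rprod_assoc)

lemma \<pi>\<^sub>0_eq_fork: "\<pi>\<^sub>0 = fork (b \<Zcomp> a) (fork a (b \<Zcomp> b))"
  by (simp add: \<pi>\<^sub>0_def fork_fork_right bprod_ac flip: rprod_assoc)

lemma rconv_P: "P\<^sup>\<smile> = P"
  by (simp add: P_def rconv_bprod rconv_rprod bprod_comm)

lemma rconv_R: "R\<^sup>\<smile> = fork (a \<Zcomp> a) (fork (a \<Zcomp> b) b)"
  by (simp add: R_def fork_fork_right rconv_bprod rconv_rprod bprod_ac flip: rprod_assoc)

lemma rconv_C: "C\<^sup>\<smile> = fork (b \<Zcomp> b) (fork a (b \<Zcomp> a))"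
  by (simp add: C_def fork_fork_right rconv_bprod rconv_rprod bprod_ac flip: rprod_assoc)

lemma rconv_\<pi>\<^sub>0: "\<pi>\<^sub>0\<^sup>\<smile> = \<pi>\<^sub>0"
  by (simp add: \<pi>\<^sub>0_def rconv_bprod rconv_rprod bprod_ac flip: rprod_assoc)

text \<open>Words in \<open>a\<close> and \<open>b\<close> are kept associated to the left: \<open>fork_rprod_a\<close>, \<open>fork_rprod_b\<close> and
  \<open>fork_surjective\<close> act on the last letter.\<close>

lemmas fork_simps = U_eq_fork P_eq_fork R_eq_fork C_eq_fork \<pi>\<^sub>0_eq_fork
  rconv_P[unfolded P_eq_fork] rconv_R[unfolded R_eq_fork] rconv_C[unfolded C_eq_fork]
  rconv_\<pi>\<^sub>0[unfolded \<pi>\<^sub>0_eq_fork] defer\<^sub>0_eq_fork defer\<^sub>1_eq_fork rprod_assoc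

lemma mapping_generators [simp]: "mapping U" "mapping P" "mapping R" "mapping C" "mapping \<pi>\<^sub>0"
  by (simp_all add: fork_simps)

lemma permutational_generators [simp]:
  "permutational \<AA> P" "permutational \<AA> R" "permutational \<AA> C" "permutational \<AA> \<pi>\<^sub>0"
  by (rule permutationalI; simp add: fork_simps)+

lemma permutational_derived [simp]:
  "permutational \<AA> B" "permutational \<AA> X\<^sub>2" "permutational \<AA> X\<^sub>3"
  "permutational \<AA> C\<^sub>2" "permutational \<AA> C\<^sub>3"
  "permutational \<AA> \<pi>\<^sub>1" "permutational \<AA> \<pi>\<^sub>2" "permutational \<AA> \<pi>\<^sub>3"
  by (simp_all add: B_def X\<^sub>2_def X\<^sub>3_def C\<^sub>2_def C\<^sub>3_def \<pi>\<^sub>1_def \<pi>\<^sub>2_def \<pi>\<^sub>3_def)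

lemma R_conjugate_defer\<^sub>1:
  assumes "mapping x"
  shows "R \<Zcomp> defer\<^sub>1 x \<Zcomp> R\<^sup>\<smile> = defer\<^sub>1 (defer\<^sub>1 x)"
  using assms by (simp add: fork_simps)

lemma R_R_conjugate_defer\<^sub>1:
  assumes "mapping x"
  shows "(R \<Zcomp> R) \<Zcomp> defer\<^sub>1 x \<Zcomp> (R\<^sup>\<smile> \<Zcomp> R\<^sup>\<smile>) = defer\<^sub>1 (defer\<^sub>1 (defer\<^sub>1 x))"
proof -
  have "(R \<Zcomp> R) \<Zcomp> defer\<^sub>1 x \<Zcomp> (R\<^sup>\<smile> \<Zcomp> R\<^sup>\<smile>) = R \<Zcomp> (R \<Zcomp> defer\<^sub>1 x \<Zcomp> R\<^sup>\<smile>) \<Zcomp> R\<^sup>\<smile>"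
    using assms by (simp add: rprod_assoc)
  then show ?thesis
    using assms by (simp add: R_conjugate_defer\<^sub>1)
qed

lemma rconv_B: "B\<^sup>\<smile> = defer\<^sub>1 (R\<^sup>\<smile>)"
  by (simp add: B_def rconv_defer)

lemma C\<^sub>2_eq_fork: "C\<^sub>2 = fork (b \<Zcomp> a) (fork (b \<Zcomp> b \<Zcomp> a) (fork (b \<Zcomp> b \<Zcomp> b) a))"
  by (simp add: C\<^sub>2_def B_def fork_simps)

lemma rconv_C\<^sub>2: "C\<^sub>2\<^sup>\<smile> = fork (b \<Zcomp> b \<Zcomp> b) (fork a (fork (b \<Zcomp> a) (b \<Zcomp> b \<Zcomp> a)))"
proof -
  have "C\<^sub>2\<^sup>\<smile> = R \<Zcomp> C\<^sup>\<smile> \<Zcomp> defer\<^sub>1 (R\<^sup>\<smile>)"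
    by (simp add: C\<^sub>2_def rconv_rprod rconv_B rprod_assoc)
  then show ?thesis
    by (simp add: fork_simps)
qed

lemma X\<^sub>2_eq_defer: "X\<^sub>2 = defer\<^sub>1 B"
  and X\<^sub>3_eq_defer: "X\<^sub>3 = defer\<^sub>1 X\<^sub>2"
  by (simp_all add: X\<^sub>2_def X\<^sub>3_def B_def R_conjugate_defer\<^sub>1 R_R_conjugate_defer\<^sub>1)

lemma \<pi>\<^sub>1_eq_defer: "\<pi>\<^sub>1 = defer\<^sub>1 \<pi>\<^sub>0"
  unfolding \<pi>\<^sub>1_def rconv_C\<^sub>2 by (simp add: C\<^sub>2_eq_fork fork_simps)

lemma \<pi>\<^sub>2_eq_defer: "\<pi>\<^sub>2 = defer\<^sub>1 \<pi>\<^sub>1"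
  and \<pi>\<^sub>3_eq_defer: "\<pi>\<^sub>3 = defer\<^sub>1 \<pi>\<^sub>2"
  by (simp_all add: \<pi>\<^sub>2_def \<pi>\<^sub>3_def \<pi>\<^sub>1_eq_defer R_conjugate_defer\<^sub>1 R_R_conjugate_defer\<^sub>1)

lemmas group_fork_simps = B_def X\<^sub>2_eq_defer X\<^sub>3_eq_defer C\<^sub>2_eq_fork C\<^sub>3_def
  \<pi>\<^sub>1_eq_defer \<pi>\<^sub>2_eq_defer \<pi>\<^sub>3_eq_defer fork_simps

lemma F_group_relations:
  "(B\<^sup>\<smile> \<Zcomp> R) \<Zcomp> X\<^sub>2 = X\<^sub>2 \<Zcomp> (B\<^sup>\<smile> \<Zcomp> R)"
  "(B\<^sup>\<smile> \<Zcomp> R) \<Zcomp> X\<^sub>3 = X\<^sub>3 \<Zcomp> (B\<^sup>\<smile> \<Zcomp> R)"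
  unfolding rconv_B by (simp_all add: group_fork_simps)

lemma F_group_commutators:
  "(B\<^sup>\<smile> \<Zcomp> R) \<Zcomp> X\<^sub>2 \<Zcomp> (B\<^sup>\<smile> \<Zcomp> R)\<^sup>\<smile> \<Zcomp> X\<^sub>2\<^sup>\<smile> = \<^bold>1'"
  "(B\<^sup>\<smile> \<Zcomp> R) \<Zcomp> X\<^sub>3 \<Zcomp> (B\<^sup>\<smile> \<Zcomp> R)\<^sup>\<smile> \<Zcomp> X\<^sub>3\<^sup>\<smile> = \<^bold>1'"
  by (rule commutator_eq_rid; simp add: F_group_relations)+

lemma T_group_relations:
  "C = C\<^sub>2 \<Zcomp> B"
  "X\<^sub>2 \<Zcomp> C\<^sub>2 = C\<^sub>3 \<Zcomp> B"
  "R \<Zcomp> C = C\<^sub>2 \<Zcomp> C\<^sub>2"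
  "C \<Zcomp> C \<Zcomp> C = \<^bold>1'"
  by (simp_all add: group_fork_simps)

lemma V_group_relations:
  "\<pi>\<^sub>1 \<Zcomp> \<pi>\<^sub>1 = \<^bold>1'"
  "\<pi>\<^sub>3 \<Zcomp> \<pi>\<^sub>1 = \<pi>\<^sub>1 \<Zcomp> \<pi>\<^sub>3"
  "(\<pi>\<^sub>1 \<Zcomp> \<pi>\<^sub>2) \<Zcomp> (\<pi>\<^sub>1 \<Zcomp> \<pi>\<^sub>2) \<Zcomp> (\<pi>\<^sub>1 \<Zcomp> \<pi>\<^sub>2) = \<^bold>1'"
  "\<pi>\<^sub>1 \<Zcomp> X\<^sub>3 = X\<^sub>3 \<Zcomp> \<pi>\<^sub>1"
  "X\<^sub>2 \<Zcomp> \<pi>\<^sub>1 = \<pi>\<^sub>1 \<Zcomp> \<pi>\<^sub>2 \<Zcomp> B"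
  "B \<Zcomp> \<pi>\<^sub>2 = \<pi>\<^sub>3 \<Zcomp> B"
  "C\<^sub>3 \<Zcomp> \<pi>\<^sub>1 = \<pi>\<^sub>2 \<Zcomp> C\<^sub>3"
  "(C\<^sub>2 \<Zcomp> \<pi>\<^sub>1) \<Zcomp> (C\<^sub>2 \<Zcomp> \<pi>\<^sub>1) \<Zcomp> (C\<^sub>2 \<Zcomp> \<pi>\<^sub>1) = \<^bold>1'"
  by (simp_all add: group_fork_simps)

end

section \<open>The presentations of Thompson's groups\<close>

context projection_pair
begin

text \<open>Words of the presentations are read as composition of functions, right to left, whereas
  \<open>;\<close> composes left to right.  Sending each generator to the converse of the element it names turns
  the resulting anti-homomorphism into a homomorphism.\<close>

fun letter_value :: "tgen \<times> bool \<Rightarrow> 'a" where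
  "letter_value (GA, e) = (if e then R\<^sup>\<smile> else R)"
| "letter_value (GB, e) = (if e then B\<^sup>\<smile> else B)"
| "letter_value (GC, e) = (if e then C\<^sup>\<smile> else C)"
| "letter_value (GPi, e) = (if e then \<pi>\<^sub>0\<^sup>\<smile> else \<pi>\<^sub>0)"

abbreviation group_eval :: "(tgen \<times> bool) list \<Rightarrow> 'a"
  where "group_eval \<equiv> word_eval (Pm \<AA>) letter_value"

lemma permutational_letter_value [simp]: "permutational \<AA> (letter_value l)"
  by (cases l rule: letter_value.cases) simp_all

lemma letter_value_in_Pm: "letter_value \<in> S \<times> UNIV \<rightarrow> carrier (Pm \<AA>)"
  by simp

lemma letter_value_inv: "letter_value (g, \<not> e) = inv\<^bsub>Pm \<AA>\<^esub> letter_value (g, e)"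
  by (cases g) (simp_all add: inv_Pm)

lemma group_eval_append [simp]: "group_eval (u @ v) = group_eval u \<Zcomp> group_eval v"
  using monoid.word_eval_append[OF group.is_monoid[OF group_Pm] letter_value_in_Pm[of UNIV], of u v]
  by simp

lemma permutational_group_eval [simp]: "permutational \<AA> (group_eval w)"
  using monoid.word_eval_closed[OF group.is_monoid[OF group_Pm] letter_value_in_Pm[of UNIV], of w]
  by simp

lemma group_eval_winv [simp]: "group_eval (winv w) = (group_eval w)\<^sup>\<smile>"
  using group.word_eval_winv[OF group_Pm letter_value_in_Pm[of UNIV] letter_value_inv, of w]
  by (simp add: inv_Pm)

lemma group_eval_generators:
  "group_eval wA = R\<^sup>\<smile>" "group_eval wB = B\<^sup>\<smile>" "group_eval wC = C\<^sup>\<smile>" "group_eval wPi0 = \<pi>\<^sub>0\<^sup>\<smile>"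
  by (simp_all add: wA_def wB_def wC_def wPi0_def)

lemma group_eval_derived:
  "group_eval wX2 = X\<^sub>2\<^sup>\<smile>" "group_eval wX3 = X\<^sub>3\<^sup>\<smile>"
  "group_eval wC2 = C\<^sub>2\<^sup>\<smile>" "group_eval wC3 = C\<^sub>3\<^sup>\<smile>"
  "group_eval wPi1 = \<pi>\<^sub>1\<^sup>\<smile>" "group_eval wPi2 = \<pi>\<^sub>2\<^sup>\<smile>" "group_eval wPi3 = \<pi>\<^sub>3\<^sup>\<smile>"
  unfolding wX2_def wX3_def wC2_def wC3_def wPi1_def wPi2_def wPi3_def
    X\<^sub>2_def X\<^sub>3_def C\<^sub>2_def C\<^sub>3_def \<pi>\<^sub>1_def \<pi>\<^sub>2_def \<pi>\<^sub>3_def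
  by (simp_all add: group_eval_generators rconv_rprod rprod_assoc)

lemma group_eval_wcomm:
  assumes "group_eval u \<Zcomp> group_eval v = group_eval v \<Zcomp> group_eval u"
  shows "group_eval (wcomm u v) = \<^bold>1'"
  using commutator_eq_rid[OF _ _ assms] by (simp add: wcomm_def rprod_assoc)

lemma F_relations_hold:
  assumes "(u, v) \<in> F_relations"
  shows "group_eval u = group_eval v"
proof -
  have "group_eval (wcomm (wA @ winv wB) wX2) = \<^bold>1'" "group_eval (wcomm (wA @ winv wB) wX3) = \<^bold>1'"
    using F_group_relations[THEN arg_cong[where f = "rconv \<AA>"]]
    by (auto intro!: group_eval_wcomm simp: group_eval_generators group_eval_derived rconv_rprod)
  then show ?thesis
    using assms by (auto simp: F_relations_def)
qed

lemma T_relations_hold: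
  assumes "(u, v) \<in> T_relations"
  shows "group_eval u = group_eval v"
  using assms F_relations_hold T_group_relations[THEN arg_cong[where f = "rconv \<AA>"]]
  by (auto simp: T_relations_def group_eval_generators group_eval_derived rconv_rprod rprod_assoc)

lemma V_relations_hold:
  assumes "(u, v) \<in> V_relations"
  shows "group_eval u = group_eval v"
  using assms T_relations_hold V_group_relations[THEN arg_cong[where f = "rconv \<AA>"]]
  by (auto simp: V_relations_def group_eval_generators group_eval_derived rconv_rprod rprod_assoc)

lemmas word_defs = wA_def wB_def wC_def wPi0_def wX2_def wX3_def wC2_def wC3_def wPi1_def
  wPi2_def wPi3_def winv_def wcomm_def

lemmas group_image_letter_value =
  group.group_image_presented_group[OF group_Pm letter_value_in_Pm letter_value_inv,
    where e = False]

lemma thompson_F_image: "group_image (subgroup_generated (Pm \<AA>) {R, B}) thompson_F"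
proof -
  have "F_relations \<subseteq> lists ({GA, GB} \<times> UNIV) \<times> lists ({GA, GB} \<times> UNIV)"
    by (auto simp: F_relations_def word_defs)
  from group_image_letter_value[OF this F_relations_hold] show ?thesis
    by (simp add: thompson_F_def)
qed

lemma thompson_T_image: "group_image (subgroup_generated (Pm \<AA>) {R, B, C}) thompson_T"
proof -
  have "T_relations \<subseteq> lists ({GA, GB, GC} \<times> UNIV) \<times> lists ({GA, GB, GC} \<times> UNIV)"
    by (auto simp: T_relations_def F_relations_def word_defs)
  from group_image_letter_value[OF this T_relations_hold] show ?thesis
    by (simp add: thompson_T_def)
qed

lemma thompson_V_image: "group_image (subgroup_generated (Pm \<AA>) {R, B, C, \<pi>\<^sub>0}) thompson_V"
proof -
  have UNIV: "{GA, GB, GC, GPi} = UNIV"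
    using tgen.exhaust by auto
  have "V_relations \<subseteq> lists ({GA, GB, GC, GPi} \<times> UNIV) \<times> lists ({GA, GB, GC, GPi} \<times> UNIV)"
    by (simp add: UNIV)
  from group_image_letter_value[OF this V_relations_hold] show ?thesis
    by (simp add: thompson_V_def)
qed

section \<open>Thompson's monoid\<close>

lemma PR_relations:
  "P \<Zcomp> P = \<^bold>1'"
  "(P \<Zcomp> R) \<Zcomp> (P \<Zcomp> R) \<Zcomp> (P \<Zcomp> R) = \<^bold>1'"
  "(R \<Zcomp> P) \<Zcomp> (R \<Zcomp> P) \<Zcomp> (R \<Zcomp> P) = \<^bold>1'"
  by (simp_all add: fork_simps)

lemma U_relations: "U \<Zcomp> a = \<^bold>1'" "U \<Zcomp> b = \<^bold>1'"
  by (simp_all add: fork_simps)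

lemma defer\<^sub>0_P_relations:
  "defer\<^sub>0 P \<Zcomp> a \<Zcomp> a = a \<Zcomp> b" "defer\<^sub>0 P \<Zcomp> a \<Zcomp> b = a \<Zcomp> a" "defer\<^sub>0 P \<Zcomp> b = b"
  by (simp_all add: fork_simps)

lemma defer\<^sub>0_R_relations:
  "defer\<^sub>0 R \<Zcomp> a \<Zcomp> a \<Zcomp> a = a \<Zcomp> a" "defer\<^sub>0 R \<Zcomp> a \<Zcomp> a \<Zcomp> b = a \<Zcomp> b \<Zcomp> a"
  "defer\<^sub>0 R \<Zcomp> a \<Zcomp> b = a \<Zcomp> b \<Zcomp> b" "defer\<^sub>0 R \<Zcomp> b = b"
  by (simp_all add: fork_simps)

lemma functional_projections_U: "functional \<AA> a" "functional \<AA> b" "functional \<AA> U"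
  by simp_all

lemma functional_rconv_U: "functional \<AA> (U\<^sup>\<smile>)"
  by (rule functional_le[of a]) (simp_all add: U_def rconv_bprod bprod_le_left)

lemma fork_eq_U_defer:
  "\<lbrakk>functional \<AA> x; functional \<AA> y\<rbrakk> \<Longrightarrow> fork x y = U \<Zcomp> defer\<^sub>0 x \<Zcomp> defer\<^sub>1 y"
  by (simp add: U_eq_fork fork_rprod_defer)

lemma functional_rprod_U: "functional \<AA> x \<Longrightarrow> x \<Zcomp> U = U \<Zcomp> defer\<^sub>0 x \<Zcomp> defer\<^sub>1 x"
  using fork_eq_U_defer[of x x] by (simp add: U_eq_fork)

lemma functional_eq_U_defer:
  assumes "functional \<AA> x"
  shows "x = U \<Zcomp> defer\<^sub>0 x \<Zcomp> defer\<^sub>1 x \<Zcomp> defer\<^sub>0 a \<Zcomp> defer\<^sub>1 b"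
  using assms by (simp flip: fork_eq_U_defer add: fork_rprod_defer)

lemma rconv_R_eq: "R\<^sup>\<smile> = P \<Zcomp> R \<Zcomp> P \<Zcomp> R \<Zcomp> P"
  by (simp add: fork_simps)

lemma defer\<^sub>1_eq: "mapping x \<Longrightarrow> defer\<^sub>1 x = P \<Zcomp> defer\<^sub>0 x \<Zcomp> P"
  by (simp add: fork_simps)

lemma defer\<^sub>0_a_eq: "defer\<^sub>0 a = R\<^sup>\<smile> \<Zcomp> P \<Zcomp> R\<^sup>\<smile> \<Zcomp> b \<Zcomp> P"
  and defer\<^sub>0_b_eq: "defer\<^sub>0 b = R\<^sup>\<smile> \<Zcomp> b"
  and defer\<^sub>0_U_eq: "defer\<^sub>0 U = U \<Zcomp> defer\<^sub>0 a \<Zcomp> R"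
  by (simp_all add: fork_simps)

lemma defer\<^sub>0_defer\<^sub>0: "mapping x \<Longrightarrow> defer\<^sub>0 (defer\<^sub>0 x) = R\<^sup>\<smile> \<Zcomp> defer\<^sub>0 x \<Zcomp> R"
  by (simp add: fork_simps)

text \<open>On \<open>((p, q), r)\<close> the word takes \<open>q\<close> from a first copy and \<open>p\<close> and \<open>r\<close> from a second one:
  \<open>P\<close> and \<open>R\<close> alone preserve the cyclic order of the components.\<close>

lemma defer\<^sub>0_P_eq: "defer\<^sub>0 P = U \<Zcomp> defer\<^sub>0 a \<Zcomp> defer\<^sub>0 b \<Zcomp> P \<Zcomp> R\<^sup>\<smile> \<Zcomp> defer\<^sub>0 a \<Zcomp> R \<Zcomp> P \<Zcomp> R"
  by (simp add: fork_simps)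

lemma defer\<^sub>0_fork:
  assumes "mapping x" "mapping y"
  shows "defer\<^sub>0 (fork x y) =
    defer\<^sub>0 U \<Zcomp> defer\<^sub>0 (defer\<^sub>0 x) \<Zcomp> (defer\<^sub>0 P \<Zcomp> defer\<^sub>0 (defer\<^sub>0 y) \<Zcomp> defer\<^sub>0 P)"
  using assms by (simp add: fork_eq_U_defer defer_rprod defer\<^sub>1_eq)

lemma submonoid_generated_Fn_rprod:
  "\<lbrakk>x \<in> carrier (submonoid_generated (Fn \<AA>) S); y \<in> carrier (submonoid_generated (Fn \<AA>) S)\<rbrakk> \<Longrightarrow>
    x \<Zcomp> y \<in> carrier (submonoid_generated (Fn \<AA>) S)"
  using monoid.submonoid_generated_m_closed[OF monoid_Fn, of x S y] by simp

lemma submonoid_generated_Fn_incl: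
  "\<lbrakk>x \<in> S; functional \<AA> x\<rbrakk> \<Longrightarrow> x \<in> carrier (submonoid_generated (Fn \<AA>) S)"
  by (rule monoid.submonoid_generated_incl[OF monoid_Fn]) simp_all

abbreviation PRKU :: "'a set"
  where "PRKU \<equiv> carrier (submonoid_generated (Fn \<AA>) {P, R, a, U})"

lemma PRKU_generators: "P \<in> PRKU" "R \<in> PRKU" "a \<in> PRKU" "U \<in> PRKU"
  by (auto intro: submonoid_generated_Fn_incl)

lemma b_in_PRKU: "b \<in> PRKU"
proof -
  have "P \<Zcomp> a \<in> PRKU"
    by (intro submonoid_generated_Fn_rprod PRKU_generators)
  then show ?thesis
    by (simp add: fork_simps)
qed

lemma rconv_R_in_PRKU: "R\<^sup>\<smile> \<in> PRKU"
  unfolding rconv_R_eq by (intro submonoid_generated_Fn_rprod PRKU_generators)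

lemma defer\<^sub>0_projections_in_PRKU: "defer\<^sub>0 a \<in> PRKU" "defer\<^sub>0 b \<in> PRKU"
  unfolding defer\<^sub>0_a_eq defer\<^sub>0_b_eq
  by (intro submonoid_generated_Fn_rprod PRKU_generators b_in_PRKU rconv_R_in_PRKU)+

lemma defer\<^sub>0_P_in_PRKU: "defer\<^sub>0 P \<in> PRKU"
  unfolding defer\<^sub>0_P_eq
  by (intro submonoid_generated_Fn_rprod PRKU_generators rconv_R_in_PRKU
      defer\<^sub>0_projections_in_PRKU)

lemma defer\<^sub>0_fork_in_PRKU:
  assumes "mapping x" "mapping y" "defer\<^sub>0 x \<in> PRKU" "defer\<^sub>0 y \<in> PRKU"
  shows "defer\<^sub>0 (fork x y) \<in> PRKU"
  unfolding defer\<^sub>0_fork[OF assms(1,2)] defer\<^sub>0_U_eq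
    defer\<^sub>0_defer\<^sub>0[OF assms(1)] defer\<^sub>0_defer\<^sub>0[OF assms(2)]
  by (intro submonoid_generated_Fn_rprod PRKU_generators rconv_R_in_PRKU defer\<^sub>0_projections_in_PRKU
      defer\<^sub>0_P_in_PRKU assms)

lemma defer\<^sub>0_R_in_PRKU: "defer\<^sub>0 R \<in> PRKU"
proof -
  have "defer\<^sub>0 (fork (fork a (b \<Zcomp> a)) (b \<Zcomp> b)) \<in> PRKU"
    by (intro defer\<^sub>0_fork_in_PRKU)
      (simp_all add: defer_rprod submonoid_generated_Fn_rprod defer\<^sub>0_projections_in_PRKU)
  then show ?thesis
    by (simp only: R_eq_fork[symmetric])
qed

lemma submonoid_generated_deferred_eq:
  "submonoid_generated (Fn \<AA>) {defer\<^sub>0 P, defer\<^sub>0 R, a, U} =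
    submonoid_generated (Fn \<AA>) {P, R, a, U}"
proof (rule monoid.submonoid_generated_eqI[OF monoid_Fn])
  show "{defer\<^sub>0 P, defer\<^sub>0 R, a, U} \<subseteq> PRKU"
    by (simp add: PRKU_generators defer\<^sub>0_P_in_PRKU defer\<^sub>0_R_in_PRKU)
  let ?H = "carrier (submonoid_generated (Fn \<AA>) {defer\<^sub>0 P, defer\<^sub>0 R, a, U})"
  have "U \<Zcomp> defer\<^sub>0 P \<Zcomp> a \<in> ?H" "U \<Zcomp> defer\<^sub>0 R \<Zcomp> a \<in> ?H"
    by (intro submonoid_generated_Fn_rprod submonoid_generated_Fn_incl; simp)+
  moreover have "U \<Zcomp> defer\<^sub>0 P \<Zcomp> a = P" "U \<Zcomp> defer\<^sub>0 R \<Zcomp> a = R"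
    by (simp_all add: fork_simps)
  ultimately show "{P, R, a, U} \<subseteq> ?H"
    by (simp add: submonoid_generated_Fn_incl)
qed

fun generator_value :: "mgen \<Rightarrow> 'a" where
  "generator_value gK = a"
| "generator_value gL = b"
| "generator_value gU = U"
| "generator_value gP0 = defer\<^sub>0 P"
| "generator_value gR0 = defer\<^sub>0 R"

abbreviation monoid_eval :: "mgen list \<Rightarrow> 'a"
  where "monoid_eval \<equiv> word_eval (Fn \<AA>) generator_value"

lemma mapping_generator_value [simp]: "mapping (generator_value g)"
  by (cases g) simp_all

lemma mapping_monoid_eval [simp]: "mapping (monoid_eval w)"
  by (induction w) simp_all

lemma generator_value_in_Fn: "generator_value \<in> S \<rightarrow> carrier (Fn \<AA>)"
  by simp

lemma monoid_eval_append [simp]: "monoid_eval (u @ v) = monoid_eval u \<Zcomp> monoid_eval v"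
  using monoid.word_eval_append[OF monoid_Fn generator_value_in_Fn[of UNIV], of u v] by simp

lemma monoid_eval_mP: "monoid_eval mP = P"
  and monoid_eval_mR: "monoid_eval mR = R"
  by (simp_all add: mP_def mR_def fork_simps)

lemma monoid_eval_mRi: "monoid_eval mRi = R\<^sup>\<smile>"
  by (simp add: mRi_def monoid_eval_mP monoid_eval_mR rconv_R_eq rprod_assoc)

lemma monoid_eval_mK0: "monoid_eval mK0 = defer\<^sub>0 a"
  by (simp add: mK0_def monoid_eval_mP monoid_eval_mRi defer\<^sub>0_a_eq rprod_assoc)

lemma monoid_eval_gdefer0: "monoid_eval (gdefer0 g) = defer\<^sub>0 (generator_value g)"
  by (cases g) (simp_all add: monoid_eval_mR monoid_eval_mRi monoid_eval_mK0
      defer\<^sub>0_b_eq defer\<^sub>0_U_eq defer\<^sub>0_defer\<^sub>0 rprod_assoc)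

lemma monoid_eval_defer0 [simp]: "monoid_eval (defer0 w) = defer\<^sub>0 (monoid_eval w)"
proof (induction w)
  case (Cons g w)
  then show ?case
    by (simp add: defer0_def monoid_eval_gdefer0 defer_rprod)
qed (simp add: defer0_def)

lemma monoid_eval_defer1 [simp]: "monoid_eval (defer1 w) = defer\<^sub>1 (monoid_eval w)"
  by (simp add: defer1_def monoid_eval_mP defer\<^sub>1_eq rprod_assoc)

lemma M_schemes_hold:
  assumes "(u, v) \<in> M_schemes"
  shows "monoid_eval u = monoid_eval v"
  using assms unfolding M_schemes_def
proof (elim UnE)
  assume "(u, v) \<in> {(mP @ mP, []), ((mP @ mR) @ (mP @ mR) @ (mP @ mR), []),
      ((mR @ mP) @ (mR @ mP) @ (mR @ mP), [])}"
  then show ?thesis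
    using PR_relations by (auto simp: monoid_eval_mP monoid_eval_mR rprod_assoc)
next
  assume "(u, v) \<in> {(defer0 x @ defer1 y, defer1 y @ defer0 x) | x y. True}"
  then show ?thesis
    by (auto simp: defer_commute)
next
  assume "(u, v) \<in> {(x @ [gU], [gU] @ defer0 x @ defer1 x) | x. True}"
  then show ?thesis
    by (auto simp: functional_rprod_U rprod_assoc)
next
  assume "(u, v) \<in> {(x, [gU] @ defer0 x @ defer1 x @ defer0 [gK] @ defer1 [gL]) | x. True}"
  then have "v = [gU] @ defer0 u @ defer1 u @ defer0 [gK] @ defer1 [gL]"
    by auto
  then show ?thesis
    using functional_eq_U_defer[of "monoid_eval u"] by (simp add: rprod_assoc)
next
  assume "(u, v) \<in> {([gU, gK], []), ([gU, gL], []), ([gP0, gK, gK], [gK, gL]),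
      ([gP0, gK, gL], [gK, gK]), ([gP0, gL], [gL]), ([gR0, gK, gK, gK], [gK, gK]),
      ([gR0, gK, gK, gL], [gK, gL, gK]), ([gR0, gK, gL], [gK, gL, gL]), ([gR0, gL], [gL])}"
  then show ?thesis
    by (auto simp: U_relations defer\<^sub>0_P_relations defer\<^sub>0_R_relations rprod_assoc)
qed

lemma M_relations_hold: "(u, v) \<in> M_relations \<Longrightarrow> monoid_eval u = monoid_eval v"
proof (induction "(u, v)" arbitrary: u v rule: M_relations.induct)
  case scheme
  then show ?case by (rule M_schemes_hold)
next
  case (deferred u v)
  then show ?case by simp
qed

lemma thompson_M_image:
  "monoid_image (submonoid_generated (Fn \<AA>) {defer\<^sub>0 P, defer\<^sub>0 R, a, U}) thompson_M"
proof -
  let ?S = "{defer\<^sub>0 P, defer\<^sub>0 R, a, U}"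
  have "(UNIV :: mgen set) = {gK, gL, gU, gP0, gR0}"
    using mgen.exhaust by auto
  from arg_cong[OF this, of "image generator_value"] have "range generator_value = insert b ?S"
    by auto
  moreover have "submonoid_generated (Fn \<AA>) ?S = submonoid_generated (Fn \<AA>) (insert b ?S)"
  proof (rule monoid.submonoid_generated_eqI[OF monoid_Fn])
    show "?S \<subseteq> carrier (submonoid_generated (Fn \<AA>) (insert b ?S))"
      by (simp add: submonoid_generated_Fn_incl)
    show "insert b ?S \<subseteq> carrier (submonoid_generated (Fn \<AA>) ?S)"
      using b_in_PRKU unfolding submonoid_generated_deferred_eq[symmetric]
      by (simp add: submonoid_generated_Fn_incl)
  qed
  ultimately show ?thesis
    using monoid.monoid_image_presented_monoid[OF monoid_Fn generator_value_in_Fn[of UNIV] _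
        M_relations_hold]
    by (simp add: thompson_M_def)
qed

end

theorem theorem33:
  fixes \<AA> :: "('a, 'm) j_alg_scheme" (structure)
    and bsum :: "'a \<Rightarrow> 'a \<Rightarrow> 'a" and bcompl :: "'a \<Rightarrow> 'a"
    and a b K L U P P\<^sub>0 R R\<^sub>0 A B C \<pi>\<^sub>0 X\<^sub>2 X\<^sub>3 C\<^sub>2 C\<^sub>3 \<pi>\<^sub>1 \<pi>\<^sub>2 \<pi>\<^sub>3 :: 'a
    and comm :: "'a \<Rightarrow> 'a \<Rightarrow> 'a" and d\<^sub>0 d\<^sub>1 :: "'a \<Rightarrow> 'a"
  assumes alg: "j_algebra \<AA> \<or> relation_algebra \<AA> bsum bcompl"
    and ab: "a \<in> carrier \<AA>" "b \<in> carrier \<AA>"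
    and id_eqs: "\<^bold>1' = a\<^sup>\<smile> \<Zcomp> a" "\<^bold>1' = b\<^sup>\<smile> \<Zcomp> b" "\<^bold>1' = a \<Zcomp> a\<^sup>\<smile> \<cdot> b \<Zcomp> b\<^sup>\<smile>"
    and unit_eqs: "\<^bold>1 = a\<^sup>\<smile> \<Zcomp> b" "\<^bold>1 = a \<Zcomp> \<^bold>1" "\<^bold>1 = b \<Zcomp> \<^bold>1"
    and K_def: "K = a"
    and L_def: "L = b"
    and U_def: "U = a\<^sup>\<smile> \<cdot> b\<^sup>\<smile>"
    and P_def: "P = a \<Zcomp> b\<^sup>\<smile> \<cdot> b \<Zcomp> a\<^sup>\<smile>"
    and P0_def: "P\<^sub>0 = a \<Zcomp> P \<Zcomp> a\<^sup>\<smile> \<cdot> b \<Zcomp> b\<^sup>\<smile>"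
    and R_def: "R = a \<Zcomp> (a\<^sup>\<smile> \<Zcomp> a\<^sup>\<smile>) \<cdot> b \<Zcomp> a \<Zcomp> b\<^sup>\<smile> \<Zcomp> a\<^sup>\<smile> \<cdot> (b \<Zcomp> b) \<Zcomp> b\<^sup>\<smile>"
    and R0_def: "R\<^sub>0 = a \<Zcomp> R \<Zcomp> a\<^sup>\<smile> \<cdot> b \<Zcomp> b\<^sup>\<smile>"
    and A_def: "A = R"
    and B_def: "B = a \<Zcomp> a\<^sup>\<smile> \<cdot> b \<Zcomp> A \<Zcomp> b\<^sup>\<smile>"
    and C_def: "C = a \<Zcomp> (b\<^sup>\<smile> \<Zcomp> b\<^sup>\<smile>) \<cdot> b \<Zcomp> a \<Zcomp> a\<^sup>\<smile> \<cdot> (b \<Zcomp> b) \<Zcomp> a\<^sup>\<smile> \<Zcomp> b\<^sup>\<smile>"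
    and pi0_def: "\<pi>\<^sub>0 = a \<Zcomp> a\<^sup>\<smile> \<Zcomp> b\<^sup>\<smile> \<cdot> b \<Zcomp> a \<Zcomp> a\<^sup>\<smile> \<cdot> (b \<Zcomp> b) \<Zcomp> (b\<^sup>\<smile> \<Zcomp> b\<^sup>\<smile>)"
    and X2_def: "X\<^sub>2 = A \<Zcomp> B \<Zcomp> A\<^sup>\<smile>"
    and X3_def: "X\<^sub>3 = (A \<Zcomp> A) \<Zcomp> B \<Zcomp> (A\<^sup>\<smile> \<Zcomp> A\<^sup>\<smile>)"
    and C2_def: "C\<^sub>2 = B \<Zcomp> C \<Zcomp> A\<^sup>\<smile>"
    and C3_def: "C\<^sub>3 = (B \<Zcomp> B) \<Zcomp> C \<Zcomp> (A\<^sup>\<smile> \<Zcomp> A\<^sup>\<smile>)"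
    and pi1_def: "\<pi>\<^sub>1 = C\<^sub>2 \<Zcomp> \<pi>\<^sub>0 \<Zcomp> C\<^sub>2\<^sup>\<smile>"
    and pi2_def: "\<pi>\<^sub>2 = A \<Zcomp> \<pi>\<^sub>1 \<Zcomp> A\<^sup>\<smile>"
    and pi3_def: "\<pi>\<^sub>3 = (A \<Zcomp> A) \<Zcomp> \<pi>\<^sub>1 \<Zcomp> (A\<^sup>\<smile> \<Zcomp> A\<^sup>\<smile>)"
    and comm_def: "comm = (\<lambda>x y. x \<Zcomp> y \<Zcomp> x\<^sup>\<smile> \<Zcomp> y\<^sup>\<smile>)"
    and d0_def: "d\<^sub>0 = (\<lambda>x. a \<Zcomp> x \<Zcomp> a\<^sup>\<smile> \<cdot> b \<Zcomp> b\<^sup>\<smile>)"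
    and d1_def: "d\<^sub>1 = (\<lambda>x. a \<Zcomp> a\<^sup>\<smile> \<cdot> b \<Zcomp> x \<Zcomp> b\<^sup>\<smile>)"
  shows
   "\<comment> \<open>(i)\<close>
    (functional \<AA> K \<and> functional \<AA> L \<and> functional \<AA> U \<and> functional \<AA> (U\<^sup>\<smile>)) \<and>
    \<comment> \<open>(ii)\<close>
    (permutational \<AA> P \<and> permutational \<AA> P\<^sub>0 \<and> permutational \<AA> R \<and> permutational \<AA> R\<^sub>0 \<and>
     permutational \<AA> A \<and> permutational \<AA> B \<and> permutational \<AA> C \<and> permutational \<AA> \<pi>\<^sub>0) \<and>
    \<comment> \<open>(iii)\<close>
    (comm (B\<^sup>\<smile> \<Zcomp> A) X\<^sub>2 = \<^bold>1' \<and>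
     comm (B\<^sup>\<smile> \<Zcomp> A) X\<^sub>3 = \<^bold>1' \<and>
     C = C\<^sub>2 \<Zcomp> B \<and>
     X\<^sub>2 \<Zcomp> C\<^sub>2 = C\<^sub>3 \<Zcomp> B \<and>
     A \<Zcomp> C = C\<^sub>2 \<Zcomp> C\<^sub>2 \<and>
     C \<Zcomp> C \<Zcomp> C = \<^bold>1' \<and>
     \<pi>\<^sub>1 \<Zcomp> \<pi>\<^sub>1 = \<^bold>1' \<and>
     \<pi>\<^sub>3 \<Zcomp> \<pi>\<^sub>1 = \<pi>\<^sub>1 \<Zcomp> \<pi>\<^sub>3 \<and>
     (\<pi>\<^sub>1 \<Zcomp> \<pi>\<^sub>2) \<Zcomp> (\<pi>\<^sub>1 \<Zcomp> \<pi>\<^sub>2) \<Zcomp> (\<pi>\<^sub>1 \<Zcomp> \<pi>\<^sub>2) = \<^bold>1' \<and>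
     \<pi>\<^sub>1 \<Zcomp> X\<^sub>3 = X\<^sub>3 \<Zcomp> \<pi>\<^sub>1 \<and>
     X\<^sub>2 \<Zcomp> \<pi>\<^sub>1 = \<pi>\<^sub>1 \<Zcomp> \<pi>\<^sub>2 \<Zcomp> B \<and>
     B \<Zcomp> \<pi>\<^sub>2 = \<pi>\<^sub>3 \<Zcomp> B \<and>
     C\<^sub>3 \<Zcomp> \<pi>\<^sub>1 = \<pi>\<^sub>2 \<Zcomp> C\<^sub>3 \<and>
     (C\<^sub>2 \<Zcomp> \<pi>\<^sub>1) \<Zcomp> (C\<^sub>2 \<Zcomp> \<pi>\<^sub>1) \<Zcomp> (C\<^sub>2 \<Zcomp> \<pi>\<^sub>1) = \<^bold>1') \<and>
    \<comment> \<open>(iv)\<close>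
    group_image (subgroup_generated (Pm \<AA>) {A, B}) thompson_F \<and>
    \<comment> \<open>(v)\<close>
    group_image (subgroup_generated (Pm \<AA>) {A, B, C}) thompson_T \<and>
    \<comment> \<open>(vi)\<close>
    group_image (subgroup_generated (Pm \<AA>) {A, B, C, \<pi>\<^sub>0}) thompson_V \<and>
    \<comment> \<open>(vii)\<close>
    submonoid_generated (Fn \<AA>) {P\<^sub>0, R\<^sub>0, K, U} = submonoid_generated (Fn \<AA>) {P, R, K, U} \<and>
    \<comment> \<open>(viii)\<close>
    (P \<Zcomp> P = \<^bold>1' \<and>
     (P \<Zcomp> R) \<Zcomp> (P \<Zcomp> R) \<Zcomp> (P \<Zcomp> R) = \<^bold>1' \<and>
     (R \<Zcomp> P) \<Zcomp> (R \<Zcomp> P) \<Zcomp> (R \<Zcomp> P) = \<^bold>1' \<and>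
     (\<forall>x \<in> carrier (Fn \<AA>). d\<^sub>0 x \<in> carrier (Fn \<AA>) \<and> d\<^sub>1 x \<in> carrier (Fn \<AA>)) \<and>
     (\<forall>x \<in> carrier (Fn \<AA>). \<forall>y \<in> carrier (Fn \<AA>). d\<^sub>0 x \<Zcomp> d\<^sub>1 y = d\<^sub>1 y \<Zcomp> d\<^sub>0 x) \<and>
     (\<forall>x \<in> carrier (Fn \<AA>). x \<Zcomp> U = U \<Zcomp> d\<^sub>0 x \<Zcomp> d\<^sub>1 x) \<and>
     (\<forall>x \<in> carrier (Fn \<AA>). x = U \<Zcomp> d\<^sub>0 x \<Zcomp> d\<^sub>1 x \<Zcomp> d\<^sub>0 K \<Zcomp> d\<^sub>1 L) \<and>
     U \<Zcomp> K = \<^bold>1' \<and>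
     U \<Zcomp> L = \<^bold>1' \<and>
     P\<^sub>0 \<Zcomp> K \<Zcomp> K = K \<Zcomp> L \<and>
     P\<^sub>0 \<Zcomp> K \<Zcomp> L = K \<Zcomp> K \<and>
     P\<^sub>0 \<Zcomp> L = L \<and>
     R\<^sub>0 \<Zcomp> K \<Zcomp> K \<Zcomp> K = K \<Zcomp> K \<and>
     R\<^sub>0 \<Zcomp> K \<Zcomp> K \<Zcomp> L = K \<Zcomp> L \<Zcomp> K \<and>
     R\<^sub>0 \<Zcomp> K \<Zcomp> L = K \<Zcomp> L \<Zcomp> L \<and>
     R\<^sub>0 \<Zcomp> L = L) \<and>
    \<comment> \<open>(ix)\<close>
    monoid_image (submonoid_generated (Fn \<AA>) {P\<^sub>0, R\<^sub>0, K, U}) thompson_M"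
proof -
  have "allegory \<AA>"
    using alg j_algebra.is_allegory relation_algebra.is_allegory by blast
  then interpret pp: projection_pair \<AA> a b
    using ab id_eqs unit_eqs by (intro projection_pair.intro projection_pair_axioms.intro) simp_all
  have elements: "U = pp.U" "P = pp.P" "P\<^sub>0 = pp.defer\<^sub>0 pp.P" "R = pp.R" "R\<^sub>0 = pp.defer\<^sub>0 pp.R"
    "B = pp.B" "C = pp.C" "\<pi>\<^sub>0 = pp.\<pi>\<^sub>0" "X\<^sub>2 = pp.X\<^sub>2" "X\<^sub>3 = pp.X\<^sub>3" "C\<^sub>2 = pp.C\<^sub>2" "C\<^sub>3 = pp.C\<^sub>3"
    "\<pi>\<^sub>1 = pp.\<pi>\<^sub>1" "\<pi>\<^sub>2 = pp.\<pi>\<^sub>2" "\<pi>\<^sub>3 = pp.\<pi>\<^sub>3" "d\<^sub>0 = pp.defer\<^sub>0" "d\<^sub>1 = pp.defer\<^sub>1"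
    by (simp_all add: U_def P_def P0_def R_def R0_def A_def B_def C_def pi0_def X2_def X3_def C2_def
        C3_def pi1_def pi2_def pi3_def d0_def d1_def pp.element_defs fun_eq_iff)
  show ?thesis
    unfolding elements K_def L_def A_def comm_def pp.Fn_simps ball_simps mem_Collect_eq
    by (intro conjI allI impI pp.functional_projections_U pp.functional_rconv_U
        pp.permutational_generators pp.permutational_derived pp.permutational_defer
        pp.F_group_commutators pp.T_group_relations pp.V_group_relations
        pp.thompson_F_image pp.thompson_T_image pp.thompson_V_image
        pp.submonoid_generated_deferred_eq pp.PR_relations pp.functional_defer pp.defer_commute
        pp.functional_rprod_U pp.functional_eq_U_defer pp.U_relations pp.defer\<^sub>0_P_relations
        pp.defer\<^sub>0_R_relations pp.thompson_M_image)
qed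

end
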